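(* Let $\mathcal{D}$ be the generating class of a decomposable model for $m$-way contingency tables. There exists a unique minimal Markov basis for the model if and only if the number of connected components in any induced subgraph of $\mathcal{G}^{\mathcal{D}}$ is less than three.
   Context: Let $\Delta=\{1,\dots,m\}$ be the set of variables; variable $\delta$ has level set $\mathcal{I}_\delta=\{0,1,\dots,I_\delta-1\}$ with $I_\delta\ge2$, and the cells are $i=(i_1,\dots,i_m)\in\mathcal{I}=\prod_{\delta\in\Delta}\mathcal{I}_\delta$. A contingency table is a nonnegative integer array $\mathbf{n}=\{n(i)\}_{i\in\mathcal{I}}$. For $D\subset\Delta$, $\mathcal{I}_D=\prod_{\delta\in D}\mathcal{I}_\delta$, and the $D$-marginal table $\mathbf{n}_D$ has entries $n_D(i_D)=\sum_{i_{D^C}\in\mathcal{I}_{D^C}}n(i_D,i_{D^C})$. The generating class $\mathcal{D}=\{D_1,\dots,D_r\}$ is the set of facets of a simplicial complex with $\bigcup_jD_j=\Delta$. The independence graph $\mathcal{G}^{\mathcal{D}}$ has vertex set $\Delta$, with distinct $\delta,\delta'$ adjacent iff $\delta,\delta'\in D$ for some $D\in\mathcal{D}$. The model is decomposable if $\mathcal{D}$ is the set of maximal cliques of $\mathcal{G}^{\mathcal{D}}$ and $\mathcal{G}^{\mathcal{D}}$ is chordal (every cycle of length greater than three has a chord). The marginal frequencies of $\mathbf{n}$ are $\mathbf{b}=A\mathbf{n}=\{n_{D_j}(i_{D_j}) : i_{D_j}\in\mathcal{I}_{D_j},\ j=1,\dots,r\}$, and the fiber is $\mathcal{F}_{\mathbf{b}}=\{\mathbf{n}\ge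 0\mid A\mathbf{n}=\mathbf{b}\}$. A move is an integer array $\mathbf{z}=\{z(i)\}_{i\in\mathcal{I}}$ with $A\mathbf{z}=\mathbf{0}$. A finite set $\mathcal{M}$ of moves is a Markov basis if for every fiber $\mathcal{F}_{\mathbf{b}}$, any two elements of $\mathcal{F}_{\mathbf{b}}$ can be joined by a finite sequence of elements of $\mathcal{F}_{\mathbf{b}}$ in which consecutive tables differ by $\pm\mathbf{z}$ with $\mathbf{z}\in\mathcal{M}$. A Markov basis is minimal if no proper subset of it is a Markov basis. Moves are considered up to sign ($\mathbf{z}$ is identified with $-\mathbf{z}$), and uniqueness is understood with this identification. *)

theory Defs
  imports Main "HOL-Library.FuncSet" "HOL-Library.Function_Algebras"
begin

section \<open>Graphs\<close>

text \<open>A graph is a pair \<open>(V, E)\<close> of a vertex set and an adjacency relation \<open>E \<subseteq> V \<times> V\<close>,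
  symmetric and irreflexive in all uses below.\<close>

type_synonym 'a graph = "'a set \<times> ('a \<times> 'a) set"

definition induced_subgraph :: "'a graph \<Rightarrow> 'a set \<Rightarrow> 'a graph" where
  "induced_subgraph G S = (S, snd G \<inter> S \<times> S)"

text \<open>The classes of the reachability relation; for \<open>E\<close> symmetric with \<open>E \<subseteq> V \<times> V\<close>,
  \<open>E\<^sup>*\<close> restricts to an equivalence relation on \<open>V\<close> and the classes lie inside \<open>V\<close>.\<close>

definition connected_components :: "'a graph \<Rightarrow> 'a set set" where
  "connected_components G = fst G // (snd G)\<^sup>*"

definition clique :: "'a graph \<Rightarrow> 'a set \<Rightarrow> bool" where
  "clique G C \<longleftrightarrow> C \<subseteq> fst G \<and> (\<forall>x\<in>C. \<forall>y\<in>C. x \<noteq> y \<longrightarrow> (x, y) \<in> snd G)"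

definition maximal_cliques :: "'a graph \<Rightarrow> 'a set set" where
  "maximal_cliques G = {C. clique G C \<and> (\<forall>C'. clique G C' \<longrightarrow> \<not> C \<subset> C')}"

text \<open>The list of the vertices met along the cycle, without repeating the starting vertex.\<close>

definition cycle :: "'a graph \<Rightarrow> 'a list \<Rightarrow> bool" where
  "cycle G vs \<longleftrightarrow> 3 \<le> length vs \<and> distinct vs \<and> set vs \<subseteq> fst G \<and>
     (\<forall>k<length vs. (vs ! k, vs ! (Suc k mod length vs)) \<in> snd G)"

definition has_chord :: "'a graph \<Rightarrow> 'a list \<Rightarrow> bool" where
  "has_chord G vs \<longleftrightarrow> (\<exists>j<length vs. \<exists>k<length vs. j \<noteq> k \<and>
     k \<noteq> Suc j mod length vs \<and> j \<noteq> Suc k mod length vs \<and> (vs ! j, vs ! k) \<in> snd G)"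

definition chordal :: "'a graph \<Rightarrow> bool" where
  "chordal G \<longleftrightarrow> (\<forall>vs. cycle G vs \<and> length vs > 3 \<longrightarrow> has_chord G vs)"


section \<open>Generating classes and decomposable models\<close>

definition simplicial_complex :: "'a set \<Rightarrow> 'a set set \<Rightarrow> bool" where
  "simplicial_complex V K \<longleftrightarrow> K \<subseteq> Pow V \<and> (\<forall>F\<in>K. \<forall>F'. F' \<subseteq> F \<longrightarrow> F' \<in> K)"

definition facets :: "'a set set \<Rightarrow> 'a set set" where
  "facets K = {F \<in> K. \<forall>F'\<in>K. \<not> F \<subset> F'}"

definition generating_class :: "'a set \<Rightarrow> 'a set set \<Rightarrow> bool" where
  "generating_class V \<D> \<longleftrightarrow> (\<exists>K. simplicial_complex V K \<and> \<D> = facets K) \<and> \<Union>\<D> = V"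

definition independence_graph :: "'a set \<Rightarrow> 'a set set \<Rightarrow> 'a graph" where
  "independence_graph V \<D> =
     (V, {(x, y). x \<in> V \<and> y \<in> V \<and> x \<noteq> y \<and> (\<exists>D\<in>\<D>. x \<in> D \<and> y \<in> D)})"

definition decomposable :: "'a set \<Rightarrow> 'a set set \<Rightarrow> bool" where
  "decomposable V \<D> \<longleftrightarrow>
     \<D> = maximal_cliques (independence_graph V \<D>) \<and> chordal (independence_graph V \<D>)"


section \<open>Contingency tables, fibers and Markov bases\<close>

text \<open>Variables are natural numbers, \<open>V\<close> is the set of all variables of the model and \<open>I \<delta>\<close> is the
  number of levels of \<open>\<delta>\<close>. A \<open>D\<close>-marginal cell is an extensional function on \<open>D\<close>.\<close>

type_synonym cell = "nat \<Rightarrow> nat"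

definition cells :: "(nat \<Rightarrow> nat) \<Rightarrow> nat set \<Rightarrow> cell set" where
  "cells I D = (\<Pi>\<^sub>E \<delta>\<in>D. {0..<I \<delta>})"

text \<open>Integer arrays indexed by the cells are extended by zero to the whole type, so that equality
  and the pointwise group operations on functions are those of arrays.\<close>

definition int_arrays :: "nat set \<Rightarrow> (nat \<Rightarrow> nat) \<Rightarrow> (cell \<Rightarrow> int) set" where
  "int_arrays V I = {z. \<forall>i. i \<notin> cells I V \<longrightarrow> z i = 0}"

definition tables :: "nat set \<Rightarrow> (nat \<Rightarrow> nat) \<Rightarrow> (cell \<Rightarrow> int) set" where
  "tables V I = {n \<in> int_arrays V I. \<forall>i. 0 \<le> n i}"

text \<open>Here \<open>override_on j iD D\<close> is the cell composed of \<open>iD\<close> on \<open>D\<close> and \<open>j\<close> on the complement.\<close>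

definition marginal ::
  "nat set \<Rightarrow> (nat \<Rightarrow> nat) \<Rightarrow> (cell \<Rightarrow> int) \<Rightarrow> nat set \<Rightarrow> cell \<Rightarrow> int" where
  "marginal V I z D iD = (\<Sum>j\<in>cells I (V - D). z (override_on j iD D))"

text \<open>The linear map \<open>A\<close>: the family of all \<open>D\<close>-marginal entries with \<open>D \<in> \<D>\<close>, again extended
  by zero.\<close>

definition marginal_frequencies ::
  "nat set \<Rightarrow> (nat \<Rightarrow> nat) \<Rightarrow> nat set set \<Rightarrow> (cell \<Rightarrow> int) \<Rightarrow> (nat set \<times> cell \<Rightarrow> int)" where
  "marginal_frequencies V I \<D> z =
     (\<lambda>(D, iD). if D \<in> \<D> \<and> iD \<in> cells I D then marginal V I z D iD else 0)"

definition fiber ::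
  "nat set \<Rightarrow> (nat \<Rightarrow> nat) \<Rightarrow> nat set set \<Rightarrow> (nat set \<times> cell \<Rightarrow> int) \<Rightarrow> (cell \<Rightarrow> int) set" where
  "fiber V I \<D> b = {n \<in> tables V I. marginal_frequencies V I \<D> n = b}"

definition moves :: "nat set \<Rightarrow> (nat \<Rightarrow> nat) \<Rightarrow> nat set set \<Rightarrow> (cell \<Rightarrow> int) set" where
  "moves V I \<D> = {z \<in> int_arrays V I. marginal_frequencies V I \<D> z = 0}"

definition steps :: "(cell \<Rightarrow> int) set \<Rightarrow> (cell \<Rightarrow> int) set \<Rightarrow> ((cell \<Rightarrow> int) \<times> (cell \<Rightarrow> int)) set" where
  "steps F M = {(x, y). x \<in> F \<and> y \<in> F \<and> (\<exists>z\<in>M. y = x + z \<or> y = x - z)}"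

definition markov_basis ::
  "nat set \<Rightarrow> (nat \<Rightarrow> nat) \<Rightarrow> nat set set \<Rightarrow> (cell \<Rightarrow> int) set \<Rightarrow> bool" where
  "markov_basis V I \<D> M \<longleftrightarrow> finite M \<and> M \<subseteq> moves V I \<D> \<and>
     (\<forall>b. \<forall>x\<in>fiber V I \<D> b. \<forall>y\<in>fiber V I \<D> b. (x, y) \<in> (steps (fiber V I \<D> b) M)\<^sup>*)"

definition minimal_markov_basis ::
  "nat set \<Rightarrow> (nat \<Rightarrow> nat) \<Rightarrow> nat set set \<Rightarrow> (cell \<Rightarrow> int) set \<Rightarrow> bool" where
  "minimal_markov_basis V I \<D> M \<longleftrightarrow>
     markov_basis V I \<D> M \<and> (\<forall>M'. M' \<subset> M \<longrightarrow> \<not> markov_basis V I \<D> M')"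

text \<open>The image of a set of moves under the identification of \<open>z\<close> with \<open>- z\<close>.\<close>

definition up_to_sign :: "(cell \<Rightarrow> int) set \<Rightarrow> (cell \<Rightarrow> int) set set" where
  "up_to_sign M = (\<lambda>z. {z, - z}) ` M"

end

(*
  Encode a table as a multiset of records (cells). If a vertex v of the chordal graph is
  simplicial, two tables with equal clique marginals are joined by swaps of coordinates between
  two records: first join the tables without v by induction, lifting every swap (v moves along
  with its neighbours, which form a clique and hence are swapped together or not at all), then
  correct the v-coordinates, where only records agreeing on the neighbours of v are involved. So
  the moves of degree two form a Markov basis.

  The fiber of a sum of two records, differing exactly on S, consists of the sums obtained by
  swapping a union of connected components of the graph induced on S, and distinct tables in it
  have disjoint supports. If there are never three components, each such fiber has at most two
  elements, so every degree-two move is forced up to sign and the minimal basis is unique. If S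
  has three components, the fiber has at least three elements a, b, c, and a move a - b of a
  minimal basis can be exchanged for a - c and c - b, which leads to another minimal basis.
*)

theory Submission
  imports Defs "HOL-Library.Multiset"
begin

section \<open>Simplicial vertices of chordal graphs\<close>

lemma rtrancl_imp_path:
  assumes "(a, b) \<in> (E \<inter> W \<times> W)\<^sup>*" "a \<in> W"
  shows "\<exists>q. q \<noteq> [] \<and> hd q = a \<and> last q = b \<and> set q \<subseteq> W \<and> successively (\<lambda>x y. (x, y) \<in> E) q"
  using assms(1)
proof (induction rule: rtrancl_induct)
  case base
  then show ?case using assms(2) by (intro exI[of _ "[a]"]) simp
next
  case (step b c)
  then obtain q where "q \<noteq> []" "hd q = a" "last q = b" "set q \<subseteq> W"
    "successively (\<lambda>x y. (x, y) \<in> E) q" by blast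
  then show ?case using step.hyps
    by (intro exI[of _ "q @ [c]"]) (auto simp: successively_append_iff)
qed

text \<open>Only interior vertices are confined to \<open>W\<close>; the ends may lie outside.
  Repetitions are allowed, since minimal length will exclude them later.\<close>

definition path_through :: "('a \<times> 'a) set \<Rightarrow> 'a set \<Rightarrow> 'a \<Rightarrow> 'a \<Rightarrow> 'a list \<Rightarrow> bool" where
  "path_through E W s t p \<longleftrightarrow> 2 \<le> length p \<and> p ! 0 = s \<and> p ! (length p - 1) = t \<and>
     (\<forall>i. Suc i < length p \<longrightarrow> (p ! i, p ! Suc i) \<in> E) \<and>
     (\<forall>i. 0 < i \<longrightarrow> Suc i < length p \<longrightarrow> p ! i \<in> W)"

text \<open>An edge between two vertices of the path bypasses everything strictly between them, so a
  shortest path has no edge between non-consecutive vertices.\<close>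

lemma path_through_shortcut:
  assumes p: "path_through E W s t p" and "i < j" "j < length p" "(p ! i, p ! j) \<in> E"
  shows "path_through E W s t (take (Suc i) p @ drop j p)"
proof -
  let ?q = "take (Suc i) p @ drop j p"
  have len: "length ?q = Suc i + (length p - j)" using assms by simp
  have nth: "?q ! k = (if k \<le> i then p ! k else p ! (k - Suc i + j))" if "k < length ?q" for k
    using that assms by (auto simp: nth_append add.commute)
  have "(?q ! k, ?q ! Suc k) \<in> E" if "Suc k < length ?q" for k
  proof (cases "k < i")
    case True
    then show ?thesis using that assms nth[of k] nth[of "Suc k"] by (simp add: path_through_def)
  next
    case False
    show ?thesis
    proof (cases "k = i")
      case True
      then show ?thesis using that assms nth[of k] nth[of "Suc k"] by simp
    next
      case nk: False
      have "(p ! (k - Suc i + j), p ! Suc (k - Suc i + j)) \<in> E"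
        using p that len False nk assms(3) unfolding path_through_def by auto
      moreover have "Suc k - Suc i + j = Suc (k - Suc i + j)" using False nk by simp
      ultimately show ?thesis using that False nk nth[of k] nth[of "Suc k"] by simp
    qed
  qed
  moreover have "?q ! k \<in> W" if "0 < k" "Suc k < length ?q" for k
    using that assms nth[of k] len unfolding path_through_def by auto
  moreover have "?q ! (length ?q - 1) = t"
  proof -
    have "length ?q - 1 < length ?q" "\<not> length ?q - 1 \<le> i" "length ?q - 1 - Suc i + j = length p - 1"
      using assms(2,3) len by linarith+
    then show ?thesis using nth[of "length ?q - 1"] p unfolding path_through_def by metis
  qed
  moreover have "2 \<le> length ?q" using len assms(3) by linarith
  moreover have "?q ! 0 = s" using nth[of 0] p len unfolding path_through_def by (metis add_Suc le0 zero_less_Suc)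
  ultimately show ?thesis unfolding path_through_def by blast
qed

lemma ex_path_through:
  assumes "(s, a) \<in> E" "(b, t) \<in> E" "a \<in> W" "(a, b) \<in> (E \<inter> W \<times> W)\<^sup>*"
  shows "\<exists>p. path_through E W s t p"
proof -
  obtain q where q: "q \<noteq> []" "hd q = a" "last q = b" "set q \<subseteq> W"
    "successively (\<lambda>x y. (x, y) \<in> E) q"
    using rtrancl_imp_path assms by metis
  let ?p = "s # q @ [t]"
  have "successively (\<lambda>x y. (x, y) \<in> E) ?p"
    using q assms by (auto simp: successively_append_iff successively_Cons)
  then have "\<forall>i. Suc i < length ?p \<longrightarrow> (?p ! i, ?p ! Suc i) \<in> E"
    by (auto simp: successively_conv_nth)
  moreover have "?p ! i \<in> W" if "0 < i" "Suc i < length ?p" for i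
    using that q by (cases i) (auto simp: nth_append)
  moreover have "?p ! (length ?p - 1) = t" by (simp add: nth_append)
  ultimately have "path_through E W s t ?p"
    using q unfolding path_through_def by simp
  then show ?thesis ..
qed

text \<open>Otherwise a shortest path from \<open>s\<close> to \<open>t\<close> through \<open>B\<close>, closed up by \<open>u\<close>, would be a
  chordless cycle.\<close>

lemma chordal_imp_adjacent:
  assumes chordal: "chordal (V, E)" and E: "sym E" "irrefl E"
    and V: "u \<in> V" "s \<in> V" "t \<in> V" "B \<subseteq> V"
    and u: "(u, s) \<in> E" "(u, t) \<in> E" "u \<notin> B" "\<And>b. b \<in> B \<Longrightarrow> (u, b) \<notin> E"
    and "s \<noteq> t" and conn: "(s, a) \<in> E" "(t, b) \<in> E" "a \<in> B" "(a, b) \<in> (E \<inter> B \<times> B)\<^sup>*"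
  shows "(s, t) \<in> E"
proof (rule ccontr)
  assume nst: "(s, t) \<notin> E"
  have "\<exists>p. path_through E B s t p"
    using ex_path_through conn symD[OF E(1)] by metis
  then obtain p where p: "path_through E B s t p"
    and min: "\<And>q. path_through E B s t q \<Longrightarrow> length p \<le> length q"
    using ex_has_least_nat[of "path_through E B s t" _ length] by auto
  let ?n = "length p"
  have p': "2 \<le> ?n" "p ! 0 = s" "p ! (?n - 1) = t"
    "\<And>i. Suc i < ?n \<Longrightarrow> (p ! i, p ! Suc i) \<in> E" "\<And>i. 0 < i \<Longrightarrow> Suc i < ?n \<Longrightarrow> p ! i \<in> B"
    using p unfolding path_through_def by auto
  have nochord: "(p ! i, p ! j) \<notin> E" if "Suc i < j" "j < ?n" for i j
  proof
    assume "(p ! i, p ! j) \<in> E"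
    then have "path_through E B s t (take (Suc i) p @ drop j p)"
      using path_through_shortcut[OF p] that by simp
    from min[OF this] that show False by simp
  qed
  \<comment> \<open>A path with two vertices would be the missing edge itself. Hence the closed
    cycle has at least four vertices and chordality applies.\<close>
  have "?n \<noteq> 2" using p'(2,3) p'(4)[of 0] nst by auto
  with p'(1) have n3: "3 \<le> ?n" by simp
  have st: "s \<notin> B" "t \<notin> B" using u by auto
  \<comment> \<open>If \<open>p ! i\<close> recurred at a position \<open>j\<close> before the end,
    the edge from \<open>p ! j\<close> to its successor would be a forbidden edge from
    \<open>p ! i\<close>. At the end, \<open>t\<close> lies outside \<open>B\<close> and differs
    from \<open>s\<close>.\<close>
  have neq: "p ! i \<noteq> p ! j" if "i < j" "j < ?n" for i j
  proof (cases "Suc j < ?n")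
    case True
    then show ?thesis using p'(4)[of j] nochord[of i "Suc j"] that by auto
  next
    case False
    then have j: "j = ?n - 1" using that by simp
    show ?thesis
    proof (cases "i = 0")
      case True
      then show ?thesis using j p' \<open>s \<noteq> t\<close> by simp
    next
      case False
      then have "p ! i \<in> B" using p'(5)[of i] that by simp
      then show ?thesis using j p' st by auto
    qed
  qed
  have "distinct p" unfolding distinct_conv_nth by (metis neq linorder_neqE_nat)
  have setp: "set p \<subseteq> insert s (insert t B)"
  proof
    fix x assume "x \<in> set p"
    then obtain i where "i < ?n" "x = p ! i" by (auto simp: in_set_conv_nth)
    then show "x \<in> insert s (insert t B)"
      using p'(2,3) p'(5)[of i] by (cases "i = 0"; cases "Suc i < ?n") (auto simp: not_less le_Suc_eq)
  qed
  let ?c = "u # p"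
  have us: "u \<noteq> s" "u \<noteq> t" using E(2) u(1,2) by (auto simp: irrefl_def)
  have "(?c ! k, ?c ! (Suc k mod length ?c)) \<in> E" if "k < length ?c" for k
  proof (cases "k = ?n")
    case True
    then show ?thesis using p' u(2) symD[OF E(1)] by (auto simp: nth_Cons')
  next
    case False
    then show ?thesis using that p' u by (cases k) auto
  qed
  then have "cycle (V, E) ?c"
    using n3 \<open>distinct p\<close> setp us u V unfolding cycle_def by auto
  then have "has_chord (V, E) ?c"
    using chordal n3 unfolding chordal_def by auto
  then obtain j k where jk: "j < length ?c" "k < length ?c" "j \<noteq> k"
    "k \<noteq> Suc j mod length ?c" "j \<noteq> Suc k mod length ?c" "(?c ! j, ?c ! k) \<in> E"
    unfolding has_chord_def by auto
  \<comment> \<open>A chord at \<open>u\<close> would end in an interior vertex, which lies in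
    \<open>B\<close> and is no neighbour of \<open>u\<close>; a chord between path vertices
    contradicts \<open>nochord\<close>.\<close>
  have *: False if "j < k" "k < length ?c" "k \<noteq> Suc j mod length ?c" "j \<noteq> Suc k mod length ?c"
    "(?c ! j, ?c ! k) \<in> E" for j k
  proof (cases j)
    case 0
    then have "k \<noteq> 1" "k \<noteq> ?n" using that n3 by auto
    then have "?c ! k \<in> B" using that p'(5)[of "k - 1"] 0 by (cases k) auto
    then show ?thesis using that 0 u by auto
  next
    case (Suc i)
    then have "Suc i < k - 1" "k - 1 < ?n" using that by auto
    from nochord[OF this] show ?thesis using that Suc by (cases k) auto
  qed
  show False
    using *[of j k] *[of k j] jk symD[OF E(1)] by (metis linorder_neqE_nat)
qed

section \<open>Existence of simplicial vertices (Dirac)\<close>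

definition simplicial :: "('a \<times> 'a) set \<Rightarrow> 'a set \<Rightarrow> 'a \<Rightarrow> bool" where
  "simplicial E W v \<longleftrightarrow>
     (\<forall>a\<in>W. \<forall>b\<in>W. (v, a) \<in> E \<longrightarrow> (v, b) \<in> E \<longrightarrow> a \<noteq> b \<longrightarrow> (a, b) \<in> E)"

text \<open>Avoiding the neighbourhood of a prescribed \<open>u\<close> makes the induction work: in
  a smaller vertex set, the prescribed vertex can be chosen in a separating clique, which forces the
  simplicial vertex off that clique.\<close>

lemma ex_simplicial_nonadjacent:
  assumes chordal: "chordal (V, E)" and E: "sym E" "irrefl E"
    and "finite W" "W \<subseteq> V" "u \<in> W" "w \<in> W" "w \<noteq> u" "(u, w) \<notin> E"
  shows "\<exists>v\<in>W. v \<noteq> u \<and> (u, v) \<notin> E \<and> simplicial E W v"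
  using assms(4-)
proof (induction W arbitrary: u w rule: finite_psubset_induct)
  case (psubset W)
  have sE: "(x, y) \<in> E \<Longrightarrow> (y, x) \<in> E" for x y using E(1) by (rule symD)
  have IH: "\<exists>v\<in>X. v \<noteq> x \<and> (x, v) \<notin> E \<and> simplicial E X v"
    if "X \<subset> W" "x \<in> X" "y \<in> X" "y \<noteq> x" "(x, y) \<notin> E" for X x y
    using psubset.IH[OF that(1) _ that(2-)] that(1) psubset.prems(1) by blast
  \<comment> \<open>\<open>B\<close> is the component of \<open>w\<close> among the non-neighbours
    of \<open>u\<close>, and \<open>S\<close> is its boundary, separating it from the rest of
    \<open>W\<close>.\<close>
  define R where "R = {x \<in> W. x \<noteq> u \<and> (u, x) \<notin> E}"
  define B where "B = (E \<inter> R \<times> R)\<^sup>* `` {w}"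
  define S where "S = {x \<in> W - B. \<exists>b\<in>B. (b, x) \<in> E}"
  have "w \<in> R" using psubset.prems by (auto simp: R_def)
  have "w \<in> B" by (auto simp: B_def)
  have BR: "B \<subseteq> R"
  proof
    fix x assume "x \<in> B"
    then have "(w, x) \<in> (E \<inter> R \<times> R)\<^sup>*" by (simp add: B_def)
    then show "x \<in> R" using \<open>w \<in> R\<close> by (induction rule: rtrancl_induct) auto
  qed
  have step: "y \<in> B" if "x \<in> B" "(x, y) \<in> E" "y \<in> R" for x y
  proof -
    have "(w, x) \<in> (E \<inter> R \<times> R)\<^sup>*" using that(1) by (simp add: B_def)
    moreover have "(x, y) \<in> E \<inter> R \<times> R" using that BR by auto
    ultimately show ?thesis unfolding B_def by (meson Image_singleton_iff rtrancl.rtrancl_into_rtrancl)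
  qed
  have fromw: "(w, x) \<in> (E \<inter> B \<times> B)\<^sup>*" if "x \<in> B" for x
  proof -
    have "(w, x) \<in> (E \<inter> R \<times> R)\<^sup>*" using that by (simp add: B_def)
    then have "(w, x) \<in> (E \<inter> B \<times> B)\<^sup>* \<and> x \<in> B"
    proof (induction rule: rtrancl_induct)
      case base then show ?case using \<open>w \<in> B\<close> by simp
    next
      case (step y z)
      then have "z \<in> B" using \<open>\<And>x y. x \<in> B \<Longrightarrow> (x, y) \<in> E \<Longrightarrow> y \<in> R \<Longrightarrow> y \<in> B\<close> by blast
      with step show ?case by (meson IntI SigmaI IntD1 rtrancl.rtrancl_into_rtrancl)
    qed
    then show ?thesis ..
  qed
  have conn: "(x, y) \<in> (E \<inter> B \<times> B)\<^sup>*" if "x \<in> B" "y \<in> B" for x y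
  proof -
    have "sym (E \<inter> B \<times> B)" using sE by (auto simp: sym_def)
    then have "(x, w) \<in> (E \<inter> B \<times> B)\<^sup>*" using fromw[OF that(1)] by (meson sym_rtrancl symD)
    then show ?thesis using fromw[OF that(2)] by (rule rtrancl_trans)
  qed
  \<comment> \<open>A boundary vertex not adjacent to \<open>u\<close> would belong to
    \<open>R\<close> and thus be absorbed by the component \<open>B\<close>.\<close>
  have uS: "(u, s) \<in> E" if s: "s \<in> S" for s
  proof (rule ccontr)
    assume "(u, s) \<notin> E"
    obtain b where b: "b \<in> B" "(b, s) \<in> E" using s by (auto simp: S_def)
    have "s \<noteq> u" using b sE BR by (auto simp: R_def)
    then have "s \<in> R" using that \<open>(u, s) \<notin> E\<close> by (auto simp: R_def S_def)
    then have "s \<in> B" using step b by blast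
    then show False using that by (simp add: S_def)
  qed
  have Scl: "(s, t) \<in> E" if st: "s \<in> S" "t \<in> S" "s \<noteq> t" for s t
  proof -
    obtain a where a: "a \<in> B" "(a, s) \<in> E" using st by (auto simp: S_def)
    obtain b where b: "b \<in> B" "(b, t) \<in> E" using st by (auto simp: S_def)
    have "s \<in> W" "t \<in> W" using that by (auto simp: S_def)
    then show ?thesis
      using psubset.prems BR a b that
      by (intro chordal_imp_adjacent[OF chordal E, of u s t B a b])
        (auto simp: R_def intro: sE uS conn)
  qed
  \<comment> \<open>All neighbours in \<open>W\<close> of a vertex of \<open>B\<close> lie in
    \<open>B \<union> S\<close>, so simpliciality there extends to \<open>W\<close>.\<close>
  have lift: "\<exists>v\<in>W. v \<noteq> u \<and> (u, v) \<notin> E \<and> simplicial E W v"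
    if v: "v \<in> B" and simp: "simplicial E (B \<union> S) v" for v
  proof -
    have "simplicial E W v" unfolding simplicial_def
    proof (intro ballI impI)
      fix a b assume "a \<in> W" "b \<in> W" "(v, a) \<in> E" "(v, b) \<in> E" "a \<noteq> b"
      then have "a \<in> B \<union> S" "b \<in> B \<union> S" using v by (auto simp: S_def)
      then show "(a, b) \<in> E" using simp \<open>(v, a) \<in> E\<close> \<open>(v, b) \<in> E\<close> \<open>a \<noteq> b\<close>
        unfolding simplicial_def by blast
    qed
    then show ?thesis using v BR by (auto simp: R_def)
  qed
  have "u \<notin> B \<union> S" using BR uS[of u] E(2) by (auto simp: R_def irrefl_def)
  moreover have "B \<union> S \<subseteq> W" using BR by (auto simp: S_def R_def)
  ultimately have sub: "B \<union> S \<subset> W" using psubset.prems by blast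
  show ?case
  \<comment> \<open>If some \<open>s\<close> in \<open>S\<close> has a non-neighbour, induction
    gives a simplicial vertex not adjacent to \<open>s\<close>; it misses the clique
    \<open>S\<close> and so lies in \<open>B\<close>. Otherwise \<open>S\<close> is joined to
    everything, and a vertex simplicial in \<open>B\<close> stays simplicial in
    \<open>B \<union> S\<close>.\<close>
  proof (cases "\<exists>s\<in>S. \<exists>y\<in>B \<union> S. y \<noteq> s \<and> (s, y) \<notin> E")
    case True
    then obtain s y where s: "s \<in> S" "y \<in> B \<union> S" "y \<noteq> s" "(s, y) \<notin> E" by blast
    obtain v where v: "v \<in> B \<union> S" "v \<noteq> s" "(s, v) \<notin> E" "simplicial E (B \<union> S) v"
      using IH[OF sub _ s(2-4)] s(1) by blast
    then have "v \<in> B" using Scl s(1) by blast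
    then show ?thesis using lift v by blast
  next
    case False
    then have univ: "(s, y) \<in> E" if "s \<in> S" "y \<in> B \<union> S" "y \<noteq> s" for s y
      using that by auto
    have "\<exists>v\<in>B. simplicial E B v"
    proof (cases "\<exists>x\<in>B. \<exists>y\<in>B. y \<noteq> x \<and> (x, y) \<notin> E")
      case True
      then obtain x y where "x \<in> B" "y \<in> B" "y \<noteq> x" "(x, y) \<notin> E" by blast
      moreover have "B \<subset> W" using sub by blast
      ultimately show ?thesis using IH[of B x y] by blast
    next
      case False
      then have "simplicial E B w" unfolding simplicial_def by metis
      then show ?thesis using \<open>w \<in> B\<close> by blast
    qed
    then obtain v where v: "v \<in> B" "simplicial E B v" by blast
    have "simplicial E (B \<union> S) v"
      unfolding simplicial_def
    proof (intro ballI impI)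
      fix a b assume ab: "a \<in> B \<union> S" "b \<in> B \<union> S" "(v, a) \<in> E" "(v, b) \<in> E" "a \<noteq> b"
      then consider "a \<in> B" "b \<in> B" | "a \<in> S" | "b \<in> S" by blast
      then show "(a, b) \<in> E"
      proof cases
        case 1
        then show ?thesis using v(2) ab unfolding simplicial_def by blast
      next
        case 2
        then show ?thesis using univ[of a b] ab by simp
      next
        case 3
        then show ?thesis using univ[of b a] ab sE by simp
      qed
    qed
    then show ?thesis using lift v by blast
  qed
qed

lemma ex_simplicial:
  assumes "chordal (V, E)" "sym E" "irrefl E" "finite W" "W \<subseteq> V" "W \<noteq> {}"
  shows "\<exists>v\<in>W. simplicial E W v"
proof (cases "\<exists>x\<in>W. \<exists>y\<in>W. y \<noteq> x \<and> (x, y) \<notin> E")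
  case True
  then show ?thesis using ex_simplicial_nonadjacent[OF assms(1-5)] by blast
next
  case False
  then have "simplicial E W v" for v unfolding simplicial_def by metis
  then show ?thesis using assms(6) by blast
qed

section \<open>Connecting tables by swaps\<close>

text \<open>A table is a multiset of records and its \<open>C\<close>-marginal the multiset of their
  restrictions. Quantifying over all cliques, not just maximal ones, lets the condition pass
  directly to induced subgraphs.\<close>

definition same_margins :: "('a \<times> 'a) set \<Rightarrow> 'a set \<Rightarrow> ('a \<Rightarrow> 'b) multiset \<Rightarrow> ('a \<Rightarrow> 'b) multiset \<Rightarrow> bool"
  where "same_margins E W x y \<longleftrightarrow> (\<forall>C. clique (W, E) C \<longrightarrow>
     image_mset (\<lambda>i. restrict i C) x = image_mset (\<lambda>i. restrict i C) y)"

text \<open>For symmetric \<open>E\<close> this says that, among the vertices where \<open>a\<close>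
  and \<open>b\<close> differ, \<open>T\<close> cuts out a union of components of the induced
  graph.\<close>

definition swappable :: "('a \<times> 'a) set \<Rightarrow> 'a set \<Rightarrow> ('a \<Rightarrow> 'b) \<Rightarrow> ('a \<Rightarrow> 'b) \<Rightarrow> 'a set \<Rightarrow> bool" where
  "swappable E W a b T \<longleftrightarrow> T \<subseteq> W \<and>
     (\<forall>u\<in>T. \<forall>w\<in>W - T. (u, w) \<in> E \<longrightarrow> a u = b u \<or> a w = b w)"

definition swaps :: "('a \<times> 'a) set \<Rightarrow> 'a set \<Rightarrow> (('a \<Rightarrow> 'b) multiset \<times> ('a \<Rightarrow> 'b) multiset) set" where
  "swaps E W = {(add_mset a (add_mset b R),
     add_mset (override_on a b T) (add_mset (override_on b a T) R)) | a b T R. swappable E W a b T}"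

lemma same_margins_refl: "same_margins E W x x"
  by (simp add: same_margins_def)

lemma same_margins_sym: "same_margins E W x y \<Longrightarrow> same_margins E W y x"
  by (simp add: same_margins_def)

lemma same_margins_trans: "same_margins E W x y \<Longrightarrow> same_margins E W y z \<Longrightarrow> same_margins E W x z"
  by (simp add: same_margins_def)

text \<open>A clique cannot contain differing coordinates both inside and outside \<open>T\<close>.
  So on each clique the exchange either does nothing or interchanges the two restrictions.\<close>

lemma swappable_same_margins:
  assumes "swappable E W a b T"
  shows "same_margins E W {#a, b#} {#override_on a b T, override_on b a T#}"
  unfolding same_margins_def
proof (intro allI impI)
  fix C assume C: "clique (W, E) C"
  show "image_mset (\<lambda>i. restrict i C) {#a, b#} =
    image_mset (\<lambda>i. restrict i C) {#override_on a b T, override_on b a T#}"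
  proof (cases "\<exists>u\<in>T \<inter> C. a u \<noteq> b u")
    case True
    then obtain u where u: "u \<in> T" "u \<in> C" "a u \<noteq> b u" by blast
    have "a w = b w" if "w \<in> C" "w \<notin> T" for w
    proof -
      have "u \<noteq> w" "w \<in> W" "(u, w) \<in> E" using C u that by (auto simp: clique_def)
      then show ?thesis using assms u that unfolding swappable_def by blast
    qed
    then have "restrict (override_on a b T) C = restrict b C"
      "restrict (override_on b a T) C = restrict a C"
      by (auto simp: override_on_def restrict_def)
    then show ?thesis by (simp add: add_mset_commute)
  next
    case False
    then have "restrict (override_on a b T) C = restrict a C"
      "restrict (override_on b a T) C = restrict b C"
      by (auto simp: override_on_def restrict_def)
    then show ?thesis by simp
  qed
qed

lemma same_margins_union: "same_margins E W x y \<Longrightarrow> same_margins E W (x + z) (y + z)"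
  by (simp add: same_margins_def)

lemma swaps_same_margins:
  assumes "(x, y) \<in> swaps E W"
  shows "same_margins E W x y"
proof -
  obtain a b T R where *: "x = add_mset a (add_mset b R)"
    "y = add_mset (override_on a b T) (add_mset (override_on b a T) R)" "swappable E W a b T"
    using assms by (auto simp: swaps_def)
  from same_margins_union[OF swappable_same_margins[OF *(3)], of R] show ?thesis
    by (simp add: *)
qed

lemma swaps_rtrancl_same_margins:
  "(x, y) \<in> (swaps E W)\<^sup>* \<Longrightarrow> same_margins E W x y"
  by (induction rule: rtrancl_induct)
    (auto intro: same_margins_refl same_margins_trans swaps_same_margins)

lemma swaps_invariant:
  assumes "(x, y) \<in> swaps E W" "set_mset x \<subseteq> X"
    and "\<And>a b T. a \<in> X \<Longrightarrow> b \<in> X \<Longrightarrow> T \<subseteq> W \<Longrightarrow> override_on a b T \<in> X"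
  shows "set_mset y \<subseteq> X"
  using assms by (auto simp: swaps_def swappable_def)

lemma swaps_rtrancl_invariant:
  assumes "(x, y) \<in> (swaps E W)\<^sup>*" "set_mset x \<subseteq> X"
    and "\<And>a b T. a \<in> X \<Longrightarrow> b \<in> X \<Longrightarrow> T \<subseteq> W \<Longrightarrow> override_on a b T \<in> X"
  shows "set_mset y \<subseteq> X"
  using assms(1,2) by (induction rule: rtrancl_induct) (auto dest: swaps_invariant[OF _ _ assms(3)])

lemma override_on_extensional:
  "a \<in> extensional W \<Longrightarrow> b \<in> extensional W \<Longrightarrow> T \<subseteq> W \<Longrightarrow> override_on a b T \<in> extensional W"
  by (auto simp: override_on_def extensional_def)

text \<open>The neighbours of \<open>v\<close> form a clique, so those where the two records differ
  lie all inside or all outside the swapped set; \<open>v\<close> can then move with them.\<close>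

lemma lift_swap:
  assumes "sym E" "simplicial E W v" "v \<in> W"
    and "(image_mset (\<lambda>i. restrict i (W - {v})) x, y') \<in> swaps E (W - {v})"
  shows "\<exists>y. (x, y) \<in> swaps E W \<and> image_mset (\<lambda>i. restrict i (W - {v})) y = y'"
proof -
  let ?W = "W - {v}" and ?r = "\<lambda>i. restrict i (W - {v})"
  obtain a' b' T R' where x': "image_mset ?r x = add_mset a' (add_mset b' R')"
    and y': "y' = add_mset (override_on a' b' T) (add_mset (override_on b' a' T) R')"
    and ok': "swappable E ?W a' b' T"
    using assms(4) by (auto simp: swaps_def)
  obtain a x1 where a: "x = add_mset a x1" "?r a = a'" "image_mset ?r x1 = add_mset b' R'"
    using msed_map_invR[OF x'] by blast
  obtain b R where b: "x1 = add_mset b R" "?r b = b'" "image_mset ?r R = R'"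
    using msed_map_invR[OF a(3)] by blast
  have T: "T \<subseteq> ?W" using ok' by (simp add: swappable_def)
  have ok: "a u = b u \<or> a w = b w" if "u \<in> T" "w \<in> ?W - T" "(u, w) \<in> E" for u w
  proof -
    have "a' u = b' u \<or> a' w = b' w" using ok' that by (simp add: swappable_def)
    moreover have "u \<in> ?W" using T that by blast
    ultimately show ?thesis using that a(2) b(2) by auto
  qed
  \<comment> \<open>\<open>v\<close> joins the swap exactly when a neighbour in \<open>T\<close>
    really changes its value.\<close>
  define T' where "T' = (if \<exists>u\<in>T. (v, u) \<in> E \<and> a u \<noteq> b u then insert v T else T)"
  have "swappable E W a b T'" unfolding swappable_def
  proof (intro conjI ballI impI)
    show "T' \<subseteq> W" using T assms(3) by (auto simp: T'_def)
    fix u w assume uw: "u \<in> T'" "w \<in> W - T'" "(u, w) \<in> E"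
    have "T \<subseteq> T'" by (auto simp: T'_def)
    consider "u \<in> T" "w \<in> ?W - T" | "u = v" "u \<notin> T" "w \<in> ?W - T" | "u \<in> T" "w = v"
      using uw \<open>T \<subseteq> T'\<close> by (auto simp: T'_def split: if_splits)
    then show "a u = b u \<or> a w = b w"
    proof cases
      case 1
      then show ?thesis using ok uw(3) by blast
    next
      case 2
      then obtain u0 where u0: "u0 \<in> T" "(v, u0) \<in> E" "a u0 \<noteq> b u0"
        using uw(1) by (auto simp: T'_def split: if_splits)
      \<comment> \<open>Both are neighbours of the simplicial vertex \<open>v\<close>. As
        \<open>u0\<close> changes its value, the condition on this edge forces the records to agree
        at \<open>w\<close>.\<close>
      have "(u0, w) \<in> E"
        using assms(2) u0 2 uw(3) T unfolding simplicial_def by blast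
      then show ?thesis using ok u0 2 by blast
    next
      case 3
      then have "(v, u) \<in> E" using uw(3) assms(1) by (metis symD)
      then show ?thesis using 3 uw(2) by (auto simp: T'_def split: if_splits)
    qed
  qed
  then have "(x, add_mset (override_on a b T') (add_mset (override_on b a T') R)) \<in> swaps E W"
    using a(1) b(1) by (auto simp: swaps_def)
  moreover have "?r (override_on a b T') = override_on a' b' T"
    "?r (override_on b a T') = override_on b' a' T"
    using T a(2) b(2) by (auto simp: T'_def override_on_def restrict_def)
  ultimately show ?thesis using y' b(3) by (intro exI conjI) auto
qed

lemma lift_swaps:
  assumes "sym E" "simplicial E W v" "v \<in> W"
    and "(image_mset (\<lambda>i. restrict i (W - {v})) x, y') \<in> (swaps E (W - {v}))\<^sup>*"
  shows "\<exists>y. (x, y) \<in> (swaps E W)\<^sup>* \<and> image_mset (\<lambda>i. restrict i (W - {v})) y = y'"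
  using assms(4)
proof (induction rule: rtrancl_induct)
  case base
  then show ?case by blast
next
  case (step y' z')
  then obtain y where "(x, y) \<in> (swaps E W)\<^sup>*" "image_mset (\<lambda>i. restrict i (W - {v})) y = y'"
    by blast
  then show ?case using lift_swap[OF assms(1-3), of y z'] step.hyps
    by (meson rtrancl.rtrancl_into_rtrancl)
qed

lemma restrict_eqD: "restrict f A = restrict g A \<Longrightarrow> x \<in> A \<Longrightarrow> f x = g x"
  by (metis restrict_apply')

text \<open>Tables that agree on \<open>W - {v}\<close> and on the closed neighbourhood of \<open>v\<close> are joined by
  exchanging \<open>v\<close>-coordinates of pairs of records that agree on all neighbours of \<open>v\<close>; every
  exchange can be chosen to bring the tables closer together.\<close>

lemma swaps_connect_coordinate:
  assumes "v \<in> W" and N: "N = {w \<in> W. w \<noteq> v \<and> (v, w) \<in> E}"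
    and "set_mset x \<subseteq> extensional W" "set_mset y \<subseteq> extensional W"
    and "image_mset (\<lambda>i. restrict i (W - {v})) x = image_mset (\<lambda>i. restrict i (W - {v})) y"
    and "image_mset (\<lambda>i. restrict i (insert v N)) x = image_mset (\<lambda>i. restrict i (insert v N)) y"
  shows "(x, y) \<in> (swaps E W)\<^sup>*"
  using assms(3-)
proof (induction "size (x - y)" arbitrary: x rule: less_induct)
  case less
  let ?r = "\<lambda>i. restrict i (W - {v})" and ?k = "\<lambda>i. restrict i (insert v N)"
  show ?case
  proof (cases "x = y")
    case True
    then show ?thesis by simp
  next
    case False
    \<comment> \<open>The common part \<open>c\<close> is split off; the remainders \<open>p\<close>
      and \<open>q\<close> are disjoint and still have equal margins.\<close>
    define c p q where "c = x \<inter># y" and "p = x - y" and "q = y - x"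
    have xy: "x = c + p" "y = c + q"
      by (auto simp: c_def p_def q_def multiset_eq_iff)
    have pq: "p \<inter># q = {#}" by (auto simp: p_def q_def multiset_eq_iff)
    have rp: "image_mset ?r p = image_mset ?r q" and kp: "image_mset ?k p = image_mset ?k q"
      using less.prems(3,4) by (simp_all add: xy)
    have "p \<noteq> {#}"
    proof
      assume "p = {#}"
      then have "q = {#}" using rp by simp
      then show False using False xy \<open>p = {#}\<close> by simp
    qed
    \<comment> \<open>Target record \<open>f\<close> agrees with \<open>e\<close> away from
      \<open>v\<close>, and \<open>g\<close> agrees with \<open>f\<close> at \<open>v\<close> and
      its neighbours. So \<open>f\<close> is \<open>e\<close> with the \<open>v\<close>-coordinate
      of \<open>g\<close>, and exchanging \<open>v\<close> between \<open>e\<close> and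
      \<open>g\<close> is legal.\<close>
    then obtain e where e: "e \<in># p" by auto
    then have "?r e \<in># image_mset ?r q" unfolding rp[symmetric] by simp
    then obtain f where f: "f \<in># q" "?r f = ?r e" by auto
    then have "?k f \<in># image_mset ?k p" unfolding kp by simp
    then obtain g where g: "g \<in># p" "?k g = ?k f" by auto
    have disj: "i \<notin># q" if "i \<in># p" for i
      using pq that by (metis disjunct_not_in)
    have ext: "e \<in> extensional W" "f \<in> extensional W" "g \<in> extensional W"
      using less.prems(1,2) e f g xy by auto
    have NW: "N \<subseteq> W - {v}" using N by auto
    have r: "f w = e w" if "w \<in> W" "w \<noteq> v" for w using restrict_eqD[OF f(2)] that by simp
    have k: "g w = f w" if "w \<in> insert v N" for w using restrict_eqD[OF g(2) that] .
    have fe: "f = override_on e g {v}"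
    proof
      fix w show "f w = override_on e g {v} w"
        using r k ext by (cases "w \<in> W") (auto simp: override_on_def extensional_def)
    qed
    define g' where "g' = override_on g e {v}"
    have "e \<noteq> g"
    proof
      assume "e = g"
      then have "f = e" using fe by (auto simp: override_on_def)
      then show False using disj e f by blast
    qed
    then obtain p' where p': "p = add_mset e (add_mset g p')"
      using e g by (metis insert_noteq_member mset_add)
    obtain q' where q': "q = add_mset f q'" using f(1) by (metis mset_add)
    define z where "z = add_mset f (add_mset g' (c + p'))"
    have "swappable E W e g {v}"
      using assms(1) r k N by (auto simp: swappable_def)
    moreover have "x = add_mset e (add_mset g (c + p'))" using xy p' by simp
    ultimately have step: "(x, z) \<in> swaps E W"
      unfolding z_def g'_def swaps_def by (subst fe) blast
    have "?r g' = ?r g" by (auto simp: g'_def override_on_def restrict_def)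
    moreover have "?k g' = ?k e"
      using r k NW by (auto simp: g'_def override_on_def restrict_def fun_eq_iff)
    ultimately have "image_mset ?r z = image_mset ?r x" "image_mset ?k z = image_mset ?k x"
      using f(2) g(2) xy p' by (simp_all add: z_def add_mset_commute)
    moreover have "set_mset z \<subseteq> extensional W"
      by (rule swaps_invariant[OF step less.prems(1)]) (rule override_on_extensional)
    \<comment> \<open>Two surplus records are replaced by \<open>f\<close>, which \<open>y\<close>
      contains, and \<open>g'\<close>; the surplus drops by at least one.\<close>
    moreover have "size (z - y) < size (x - y)"
    proof -
      have "z - y = add_mset g' p' - q'" by (simp add: z_def xy q' add.commute)
      then have "size (z - y) \<le> size (add_mset g' p')"
        by (metis diff_subset_eq_self size_mset_mono)
      then show ?thesis using p' by (simp add: p_def)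
    qed
    ultimately have "(z, y) \<in> (swaps E W)\<^sup>*" using less by auto
    then show ?thesis using step by (rule converse_rtrancl_into_rtrancl[rotated])
  qed
qed

theorem chordal_swaps_connected:
  assumes "chordal (V, E)" "sym E" "irrefl E" "finite W" "W \<subseteq> V"
    and "set_mset x \<subseteq> extensional W" "set_mset y \<subseteq> extensional W" "same_margins E W x y"
  shows "(x, y) \<in> (swaps E W)\<^sup>*"
  using assms(4-)
proof (induction W arbitrary: x y rule: finite_psubset_induct)
  case (psubset W)
  show ?case
  proof (cases "W = {}")
    case True
    have id: "image_mset (\<lambda>i. restrict i {}) z = z" if "set_mset z \<subseteq> extensional {}"
      for z :: "('a \<Rightarrow> 'b) multiset"
      using that by (intro multiset.map_ident_strong) (auto simp: restrict_def)
    \<comment> \<open>With no variables left, the margin of the empty clique is the table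
      itself.\<close>
    have "clique (W, E) {}" by (simp add: clique_def)
    then have "x = y" using psubset.prems id True unfolding same_margins_def by metis
    then show ?thesis by simp
  next
    case False
    then obtain v where v: "v \<in> W" "simplicial E W v"
      using ex_simplicial[OF assms(1-3) psubset.hyps(1) psubset.prems(1)] by blast
    let ?W = "W - {v}" and ?r = "\<lambda>i. restrict i (W - {v})"
    have "same_margins E ?W (image_mset ?r x) (image_mset ?r y)"
      unfolding same_margins_def
    proof (intro allI impI)
      fix C assume C: "clique (?W, E) C"
      then have "clique (W, E) C" "?W \<inter> C = C" by (auto simp: clique_def)
      then show "image_mset (\<lambda>i. restrict i C) (image_mset ?r x) =
          image_mset (\<lambda>i. restrict i C) (image_mset ?r y)"
        using psubset.prems(4) by (simp add: same_margins_def multiset.map_comp comp_def)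
    qed
    moreover have "?W \<subset> W" using v by blast
    ultimately have "(image_mset ?r x, image_mset ?r y) \<in> (swaps E ?W)\<^sup>*"
      using psubset.prems(1) by (intro psubset.IH) auto
    then obtain z where z: "(x, z) \<in> (swaps E W)\<^sup>*" "image_mset ?r z = image_mset ?r y"
      using lift_swaps[OF assms(2) v(2,1)] by blast
    define N where "N = {w \<in> W. w \<noteq> v \<and> (v, w) \<in> E}"
    \<comment> \<open>Simpliciality is used a second time: the closed neighbourhood is a clique, so
      its margin agrees for \<open>z\<close> and \<open>y\<close>, as the correction of the
      \<open>v\<close>-coordinates requires.\<close>
    have "clique (W, E) (insert v N)"
    proof -
      have "(v, w) \<in> E \<and> (w, v) \<in> E" if "w \<in> N" for w
        using that symD[OF assms(2)] by (simp add: N_def)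
      moreover have "(a, b) \<in> E" if "a \<in> N" "b \<in> N" "a \<noteq> b" for a b
        using that v(2) by (simp add: N_def simplicial_def)
      moreover have "N \<subseteq> W" by (auto simp: N_def)
      ultimately show ?thesis using v(1) by (auto simp: clique_def)
    qed
    moreover have "same_margins E W z y"
      using swaps_rtrancl_same_margins[OF z(1)] psubset.prems(4)
      by (blast intro: same_margins_trans same_margins_sym)
    ultimately have "image_mset (\<lambda>i. restrict i (insert v N)) z = image_mset (\<lambda>i. restrict i (insert v N)) y"
      by (simp add: same_margins_def)
    moreover have "set_mset z \<subseteq> extensional W"
      by (rule swaps_rtrancl_invariant[OF z(1) psubset.prems(2)]) (rule override_on_extensional)
    ultimately have "(z, y) \<in> (swaps E W)\<^sup>*"
      using swaps_connect_coordinate[OF v(1) N_def] psubset.prems(3) z(2) by blast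
    then show ?thesis using z(1) by simp
  qed
qed

section \<open>Markov bases\<close>

lemma sum_inverse_restrict:
  assumes "finite V" "D \<subseteq> V" "a \<in> cells I V" "k \<in> cells I D"
  shows "(\<Sum>j\<in>cells I (V - D). if override_on j k D = a then 1 else 0) =
    (if restrict a D = k then 1 else (0::int))"
proof (cases "restrict a D = k")
  case True
  have ext: "x \<notin> V \<Longrightarrow> a x = undefined" for x using assms(3) by (auto simp: cells_def)
  have k: "x \<in> D \<Longrightarrow> k x = a x" for x using True by auto
  \<comment> \<open>The only completion of \<open>k\<close> to the cell \<open>a\<close> is by the
    part of \<open>a\<close> outside \<open>D\<close>, so a record counts exactly once in its own
    marginal cell.\<close>
  have "override_on j k D = a \<longleftrightarrow> j = restrict a (V - D)" if j: "j \<in> cells I (V - D)" for j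
  proof -
    have "x \<notin> V - D \<Longrightarrow> j x = undefined" for x using j by (auto simp: cells_def)
    then have "override_on j k D x = a x \<longleftrightarrow> j x = restrict a (V - D) x" for x
      using k ext assms(2) by (cases "x \<in> D"; cases "x \<in> V") (auto simp: override_on_def)
    then show ?thesis by (simp add: fun_eq_iff)
  qed
  then have "(\<Sum>j\<in>cells I (V - D). if override_on j k D = a then 1 else 0) =
    (\<Sum>j\<in>cells I (V - D). if j = restrict a (V - D) then 1 else (0::int))"
    by (intro sum.cong) auto
  also have "\<dots> = 1"
  proof -
    have "finite (cells I (V - D))" using assms(1) by (auto simp: cells_def intro: finite_PiE)
    moreover have "restrict a (V - D) \<in> cells I (V - D)" using assms(3) by (auto simp: cells_def)
    ultimately show ?thesis by simp
  qed
  finally show ?thesis using True by simp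
next
  case False
  have "override_on j k D \<noteq> a" for j
  proof
    assume "override_on j k D = a"
    then have "restrict a D = restrict k D" by (auto simp: override_on_def restrict_def)
    also have "\<dots> = k" using assms(4) by (auto simp: cells_def PiE_def extensional_restrict)
    finally show False using False by simp
  qed
  then show ?thesis using False by simp
qed

text \<open>The bridge between multisets of records and integer arrays: it is additive and
  injective, and for finite \<open>V\<close> reaches every table by \<open>ex_tab\<close>.\<close>

definition tab :: "cell multiset \<Rightarrow> cell \<Rightarrow> int" where
  "tab M = (\<lambda>i. int (count M i))"

lemma tab_union: "tab (M + N) = tab M + tab N"
  by (simp add: tab_def fun_eq_iff)

lemma tab_inject: "tab M = tab N \<longleftrightarrow> M = N"
  by (auto simp: tab_def fun_eq_iff multiset_eq_iff)

lemma marginal_tab: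
  assumes "finite V" "D \<subseteq> V" "set_mset M \<subseteq> cells I V" "k \<in> cells I D"
  shows "marginal V I (tab M) D k = int (count (image_mset (\<lambda>i. restrict i D) M) k)"
  using assms(3)
proof (induction M)
  case empty
  then show ?case by (simp add: marginal_def tab_def)
next
  case (add a M)
  have "marginal V I (tab (add_mset a M)) D k =
    (\<Sum>j\<in>cells I (V - D). tab M (override_on j k D) + (if override_on j k D = a then 1 else 0))"
    unfolding marginal_def by (intro sum.cong) (auto simp: tab_def)
  also have "\<dots> = marginal V I (tab M) D k + (if restrict a D = k then 1 else 0)"
    using sum_inverse_restrict[OF assms(1,2) _ assms(4)] add.prems
    by (simp add: sum.distrib marginal_def)
  finally show ?case using add by (simp add: restrict_def)
qed

section \<open>Fibers, minimal bases and exchange of moves\<close>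

lemma marginal_frequencies_add:
  "marginal_frequencies V I \<D> (x + y) = marginal_frequencies V I \<D> x + marginal_frequencies V I \<D> y"
  by (auto simp: marginal_frequencies_def marginal_def fun_eq_iff sum.distrib)

lemma marginal_frequencies_diff:
  "marginal_frequencies V I \<D> (x - y) = marginal_frequencies V I \<D> x - marginal_frequencies V I \<D> y"
  by (auto simp: marginal_frequencies_def marginal_def fun_eq_iff sum_subtractf)

lemma fiber_diff_in_moves:
  assumes "x \<in> fiber V I \<D> b" "y \<in> fiber V I \<D> b"
  shows "x - y \<in> moves V I \<D>"
  using assms by (auto simp: fiber_def moves_def tables_def int_arrays_def marginal_frequencies_diff)

lemma fiber_nonneg: "x \<in> fiber V I \<D> b \<Longrightarrow> 0 \<le> x i"
  by (simp add: fiber_def tables_def)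

lemma fiber_shift:
  assumes "x \<in> fiber V I \<D> b" "a \<in> fiber V I \<D> b'" "c \<in> fiber V I \<D> b'" "\<And>i. a i \<le> x i"
  shows "x - a + c \<in> fiber V I \<D> b"
proof -
  have "0 \<le> x i - a i + c i" for i using assms(4)[of i] fiber_nonneg[OF assms(3), of i] by linarith
  then show ?thesis
    using assms by (auto simp: fiber_def tables_def int_arrays_def marginal_frequencies_diff
      marginal_frequencies_add)
qed

text \<open>Paths concatenate, so it suffices to simulate single steps of \<open>M\<close> by paths
  of \<open>M'\<close> in the same fiber.\<close>

lemma markov_basis_mono_steps:
  assumes "markov_basis V I \<D> M" "finite M'" "M' \<subseteq> moves V I \<D>"
    and "\<And>b. steps (fiber V I \<D> b) M \<subseteq> (steps (fiber V I \<D> b) M')\<^sup>*"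
  shows "markov_basis V I \<D> M'"
  using assms rtrancl_subset_rtrancl[OF assms(4)] unfolding markov_basis_def by blast

lemma ex_minimal_markov_basis:
  assumes "markov_basis V I \<D> M"
  shows "\<exists>M'\<subseteq>M. minimal_markov_basis V I \<D> M'"
proof -
  have "finite M" using assms by (simp add: markov_basis_def)
  then show ?thesis using assms
  proof (induction M rule: finite_psubset_induct)
    case (psubset M)
    show ?case
    proof (cases "minimal_markov_basis V I \<D> M")
      case False
      then obtain M' where "M' \<subset> M" "markov_basis V I \<D> M'"
        using psubset.prems by (auto simp: minimal_markov_basis_def)
      with psubset.IH show ?thesis by (meson psubset_imp_subset subset_trans)
    qed blast
  qed
qed

text \<open>A path between distinct tables contains a step that changes the table; a zero move in
  \<open>M\<close> could make other steps stationary.\<close>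

lemma markov_basis_step:
  assumes "markov_basis V I \<D> M" "x \<in> fiber V I \<D> b" "y \<in> fiber V I \<D> b" "x \<noteq> y"
  shows "\<exists>p\<in>fiber V I \<D> b. \<exists>q\<in>fiber V I \<D> b. p \<noteq> q \<and> (q - p \<in> M \<or> p - q \<in> M)"
proof -
  let ?R = "steps (fiber V I \<D> b) M"
  have "(x, y) \<in> ?R\<^sup>*" using assms by (simp add: markov_basis_def)
  then have "\<exists>(p, q)\<in>?R. p \<noteq> q"
    using assms(4) by (induction rule: rtrancl_induct) auto
  then obtain p q where pq: "(p, q) \<in> ?R" "p \<noteq> q" by blast
  then obtain z where "z \<in> M" "q = p + z \<or> q = p - z" by (auto simp: steps_def)
  then have "q - p \<in> M \<or> p - q \<in> M" by (auto simp: algebra_simps)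
  then show ?thesis using pq by (auto simp: steps_def)
qed

text \<open>A step by \<open>a - b\<close>, in any fiber, is replaced by a detour in which
  \<open>c\<close> takes the place of the removed table before the other one is inserted.\<close>

lemma markov_basis_exchange:
  assumes M: "markov_basis V I \<D> M"
    and F: "a \<in> fiber V I \<D> b0" "b \<in> fiber V I \<D> b0" "c \<in> fiber V I \<D> b0"
    and disj: "\<And>i. a i = 0 \<or> b i = 0"
  shows "markov_basis V I \<D> (M - {a - b, b - a} \<union> {a - c, c - b})" (is "markov_basis V I \<D> ?M")
proof (rule markov_basis_mono_steps[OF M])
  show "finite ?M" using M by (simp add: markov_basis_def)
  show "?M \<subseteq> moves V I \<D>"
    using M F fiber_diff_in_moves unfolding markov_basis_def by blast
  fix f
  let ?F = "fiber V I \<D> f"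
  show "steps ?F M \<subseteq> (steps ?F ?M)\<^sup>*"
  proof (intro subrelI)
    fix x y assume "(x, y) \<in> steps ?F M"
    then obtain z where z: "x \<in> ?F" "y \<in> ?F" "z \<in> M" "y = x + z \<or> y = x - z"
      by (auto simp: steps_def)
    have "z \<in> ?M \<or> z = a - b \<or> z = b - a" using z(3) by blast
    moreover have "y = x - b + a \<or> y = x - a + b" if "z = a - b \<or> z = b - a"
      using z(4) that by (auto simp: algebra_simps)
    ultimately consider "z \<in> ?M" | "y = x - b + a" | "y = x - a + b" by blast
    then show "(x, y) \<in> (steps ?F ?M)\<^sup>*"
    proof cases
      case 1
      then have "(x, y) \<in> steps ?F ?M" using z unfolding steps_def by blast
      then show ?thesis by blast
    next
      case 2
      \<comment> \<open>Where \<open>b\<close> is positive, \<open>a\<close> vanishes, so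
        nonnegativity of \<open>y\<close> gives the bound. Hence \<open>b\<close> can be subtracted
        before \<open>c\<close> is added.\<close>
      have "b i \<le> x i" for i
        using disj[of i] fiber_nonneg[OF z(1), of i] fiber_nonneg[OF z(2), of i] 2 by auto
      then have mid: "x - b + c \<in> ?F" using fiber_shift z(1) F by blast
      have "x - b + c = x + (c - b)" "y = x - b + c + (a - c)"
        using 2 by (simp_all add: algebra_simps)
      then have "(x, x - b + c) \<in> steps ?F ?M" "(x - b + c, y) \<in> steps ?F ?M"
        using mid z unfolding steps_def by blast+
      then show ?thesis by (meson r_into_rtrancl rtrancl_trans)
    next
      case 3
      have "a i \<le> x i" for i
        using disj[of i] fiber_nonneg[OF z(1), of i] fiber_nonneg[OF z(2), of i] 3 by auto
      then have mid: "x - a + c \<in> ?F" using fiber_shift z(1) F by blast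
      have "x - a + c = x - (a - c)" "y = x - a + c - (c - b)"
        using 3 by (simp_all add: algebra_simps)
      then have "(x, x - a + c) \<in> steps ?F ?M" "(x - a + c, y) \<in> steps ?F ?M"
        using mid z unfolding steps_def by blast+
      then show ?thesis by (meson r_into_rtrancl rtrancl_trans)
    qed
  qed
qed

lemma not_unique_minimal_markov_basis:
  assumes M: "markov_basis V I \<D> M"
    and F: "x \<in> fiber V I \<D> f" "y \<in> fiber V I \<D> f" "w \<in> fiber V I \<D> f"
      "x \<noteq> y" "x \<noteq> w" "y \<noteq> w"
    and disj: "\<And>p q i. p \<in> fiber V I \<D> f \<Longrightarrow> q \<in> fiber V I \<D> f \<Longrightarrow> p \<noteq> q \<Longrightarrow> p i = 0 \<or> q i = 0"
  shows "\<not> (\<exists>!B. B \<in> up_to_sign ` {M. minimal_markov_basis V I \<D> M})"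
proof
  let ?F = "fiber V I \<D> f"
  assume uniq: "\<exists>!B. B \<in> up_to_sign ` {M. minimal_markov_basis V I \<D> M}"
  obtain M1 where M1: "minimal_markov_basis V I \<D> M1"
    using ex_minimal_markov_basis[OF M] by blast
  then have "markov_basis V I \<D> M1" by (simp add: minimal_markov_basis_def)
  then obtain a b where ab: "a \<in> ?F" "b \<in> ?F" "a \<noteq> b" "a - b \<in> M1"
    using markov_basis_step[OF _ F(1,2,4)] by metis
  \<comment> \<open>Among the three given tables at least one differs from both \<open>a\<close> and
    \<open>b\<close>.\<close>
  obtain c where c: "c \<in> ?F" "c \<noteq> a" "c \<noteq> b" using F by metis
  define M' where "M' = M1 - {a - b, b - a} \<union> {a - c, c - b}"
  have "markov_basis V I \<D> M'" unfolding M'_def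
    using \<open>markov_basis V I \<D> M1\<close> ab c disj by (intro markov_basis_exchange[where ?b0.0 = f]) auto
  \<comment> \<open>The exchanged basis need not be minimal, but any minimal basis inside it still
    omits both signs of \<open>a - b\<close>.\<close>
  then obtain M2 where M2: "M2 \<subseteq> M'" "minimal_markov_basis V I \<D> M2"
    using ex_minimal_markov_basis by blast
  \<comment> \<open>A new move could equal \<open>b - a\<close> only if \<open>a + a = b + c\<close>
    or \<open>b + b = a + c\<close>; disjoint supports exclude both.\<close>
  have double: "p + p \<noteq> q + r" if "p \<in> ?F" "q \<in> ?F" "r \<in> ?F" "p \<noteq> q" "p \<noteq> r" for p q r
  proof
    assume eq: "p + p = q + r"
    have "p i = q i" for i
    proof -
      have "p i + p i = q i + r i" using fun_cong[OF eq, of i] by simp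
      then show ?thesis
        using disj[OF that(1,2,4), of i] disj[OF that(1,3,5), of i] fiber_nonneg[OF that(2), of i]
          fiber_nonneg[OF that(3), of i] by linarith
    qed
    then show False using that(4) by blast
  qed
  have "a - c \<noteq> a - b" "c - b \<noteq> a - b" using c by auto
  moreover have "a - c \<noteq> b - a" using double[of a b c] ab c by (auto simp: algebra_simps)
  moreover have "c - b \<noteq> b - a" using double[of b a c] ab c by (auto simp: algebra_simps)
  ultimately have "a - b \<notin> M2" "b - a \<notin> M2" using M2(1) by (auto simp: M'_def)
  then have "{a - b, - (a - b)} \<notin> up_to_sign M2"
    by (auto simp: up_to_sign_def doubleton_eq_iff)
  moreover have "{a - b, - (a - b)} \<in> up_to_sign M1" using ab(4) by (auto simp: up_to_sign_def)
  ultimately have "up_to_sign M1 \<noteq> up_to_sign M2" by blast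
  then show False using uniq M1 M2(2) by blast
qed

section \<open>Fibers of degree two\<close>

lemma ex_maximal_clique:
  assumes "finite V" "clique (V, E) C"
  shows "\<exists>D\<in>maximal_cliques (V, E). C \<subseteq> D"
proof -
  let ?A = "{D. clique (V, E) D}"
  have "finite ?A" using assms(1) by (intro finite_subset[of ?A "Pow V"]) (auto simp: clique_def)
  then obtain D where "clique (V, E) D" "C \<subseteq> D" "\<And>D'. clique (V, E) D' \<Longrightarrow> D \<subseteq> D' \<Longrightarrow> D = D'"
    using finite_has_maximal2[of ?A C] assms(2) by auto
  then show ?thesis unfolding maximal_cliques_def by blast
qed

lemma rtrancl_imp_iff:
  assumes "(s, t) \<in> R\<^sup>*" "\<And>u w. (u, w) \<in> R \<Longrightarrow> P u = P w"
  shows "P s = P t"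
  using assms(1) by (induction rule: rtrancl_induct) (auto dest: assms(2))

text \<open>Two properties constant along \<open>R\<close> act as labels of the classes:
  \<open>P\<close> separates \<open>r\<close> from \<open>p\<close>, and \<open>Q\<close> separates
  \<open>q\<close> from both.\<close>

lemma three_le_card_classes:
  assumes "finite S" "r \<in> S" "p \<in> S" "q \<in> S"
    and P: "\<And>u w. (u, w) \<in> R \<Longrightarrow> P u = P w" and Q: "\<And>u w. (u, w) \<in> R \<Longrightarrow> Q u = Q w"
    and "P r" "Q r" "\<not> P p" "Q p" "\<not> Q q"
  shows "3 \<le> card (S // R\<^sup>*)"
proof -
  have neq: "R\<^sup>* `` {x} \<noteq> R\<^sup>* `` {y}" if "P x \<noteq> P y \<or> Q x \<noteq> Q y" for x y
  proof
    assume "R\<^sup>* `` {x} = R\<^sup>* `` {y}"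
    then have "(x, y) \<in> R\<^sup>*" by blast
    then show False using rtrancl_imp_iff[of x y R P] rtrancl_imp_iff[of x y R Q] P Q that by blast
  qed
  have "finite (S // R\<^sup>*)" using assms(1) by (simp add: quotient_def)
  moreover have "{R\<^sup>* `` {r}, R\<^sup>* `` {p}, R\<^sup>* `` {q}} \<subseteq> S // R\<^sup>*"
    using assms(2-4) by (auto simp: quotient_def)
  moreover have "card {R\<^sup>* `` {r}, R\<^sup>* `` {p}, R\<^sup>* `` {q}} = 3"
    using neq[of r p] neq[of r q] neq[of p q] assms(7-) by simp
  ultimately show ?thesis by (metis card_mono)
qed

lemma same_margins_size: "same_margins E V x y \<Longrightarrow> size x = size y"
proof -
  assume "same_margins E V x y"
  then have "image_mset (\<lambda>i. restrict i {}) x = image_mset (\<lambda>i. restrict i {}) y"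
    by (simp add: same_margins_def clique_def)
  then show ?thesis by (metis size_image_mset)
qed

text \<open>Equality of the two-element multisets of restrictions fixes one matching of the records
  for the whole clique; different cliques may need different matchings.\<close>

lemma same_margins_pair_clique:
  assumes "same_margins E V {#a, b#} {#c, d#}" "clique (V, E) C"
  shows "(\<forall>u\<in>C. c u = a u \<and> d u = b u) \<or> (\<forall>u\<in>C. c u = b u \<and> d u = a u)"
proof -
  have "{#restrict a C, restrict b C#} = {#restrict c C, restrict d C#}"
    using assms by (simp add: same_margins_def)
  then have "restrict a C = restrict c C \<and> restrict b C = restrict d C \<or>
    restrict a C = restrict d C \<and> restrict b C = restrict c C"
    by (auto simp: add_eq_conv_ex)
  then show ?thesis by (metis restrict_eqD)
qed

lemma same_margins_pair_cancel:
  assumes "same_margins E V {#a, b#} {#a, d#}" "b \<in> extensional V" "d \<in> extensional V"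
  shows "b = d"
proof
  fix u
  show "b u = d u"
  proof (cases "u \<in> V")
    case True
    then have "clique (V, E) {u}" by (simp add: clique_def)
    from same_margins_pair_clique[OF assms(1) this] show ?thesis by auto
  next
    case False
    then show ?thesis using assms by (simp add: extensional_def)
  qed
qed

lemma size_2_add_mset: "size M = 2 \<Longrightarrow> i \<in># M \<Longrightarrow> \<exists>b. M = {#i, b#}"
  by (auto dest!: multi_member_split simp: size_1_singleton_mset)

text \<open>If two such tables shared a record, it would cancel, and the singleton cliques would
  force the remaining records to coincide.\<close>

lemma same_margins_pair_disjoint:
  assumes "same_margins E V x y" "size x = 2" "set_mset x \<subseteq> extensional V"
    "set_mset y \<subseteq> extensional V" "x \<noteq> y" "i \<in># x"
  shows "i \<notin># y"
proof
  assume "i \<in># y"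
  have "size y = 2" using assms(1,2) same_margins_size by metis
  then obtain b d where "x = {#i, b#}" "y = {#i, d#}"
    using size_2_add_mset assms(2,6) \<open>i \<in># y\<close> by metis
  then show False using same_margins_pair_cancel[of E V i b d] assms by auto
qed

text \<open>On the set \<open>S\<close> of variables where the two records of \<open>X\<close> differ, every table of the fiber
  is a two-colouring that is constant on components; two further tables separate three of them.\<close>

lemma three_tables_imp_three_components:
  assumes "finite V" "E \<subseteq> V \<times> V" "irrefl E" "sym E"
    and size: "size X = 2" and ext: "set_mset X \<subseteq> extensional V" "set_mset Y \<subseteq> extensional V"
      "set_mset Z \<subseteq> extensional V"
    and Y: "same_margins E V X Y" and Z: "same_margins E V X Z"
    and neq: "X \<noteq> Y" "X \<noteq> Z" "Y \<noteq> Z"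
  shows "\<exists>S\<subseteq>V. 3 \<le> card (connected_components (induced_subgraph (V, E) S))"
proof -
  obtain a b where X: "X = {#a, b#}" using size by (metis size_2_add_mset size_eq_Suc_imp_elem numeral_2_eq_2)
  define S where "S = {v \<in> V. a v \<noteq> b v}"
  define R where "R = E \<inter> S \<times> S"
  have single: "v \<in> V \<Longrightarrow> clique (V, E) {v}" for v by (simp add: clique_def)
  have ab: "a \<in> extensional V" "b \<in> extensional V" using ext(1) X by auto
  have sizes: "size Y = 2" "size Z = 2" using same_margins_size Y Z size by metis+
  \<comment> \<open>If the records of \<open>X\<close> coincided, \<open>X\<close> would be alone in
    its fiber, contrary to \<open>Y\<close>.\<close>
  have "S \<noteq> {}"
  proof
    assume S: "S = {}"
    obtain c d where cd: "Y = {#c, d#}" using sizes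
      by (metis size_2_add_mset size_eq_Suc_imp_elem numeral_2_eq_2)
    have "c u = a u" for u
    proof (cases "u \<in> V")
      case True
      have "a u = b u" using True S by (auto simp: S_def)
      then show ?thesis using same_margins_pair_clique[OF Y[unfolded X cd] single[OF True]] by auto
    next
      case False
      then show ?thesis using ab ext(2) cd by (auto simp: extensional_def)
    qed
    then have "c = a" by blast
    then have "a \<in># Y" using cd by simp
    moreover have "a \<in># X" by (simp add: X)
    ultimately show False using same_margins_pair_disjoint[OF Y size ext(1,2) neq(1)] by blast
  qed
  then obtain r where r: "r \<in> S" by blast
  have rV: "r \<in> V" using r by (simp add: S_def)
  \<comment> \<open>The reference vertex \<open>r\<close> orders the two records of each table: the
    first is the one following \<open>a\<close> at \<open>r\<close>.\<close>
  have orient: "\<exists>c d. T = {#c, d#} \<and> c r = a r" if T: "size T = 2" "same_margins E V X T" for T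
  proof -
    obtain c d where cd: "T = {#c, d#}" using T(1)
      by (metis size_2_add_mset size_eq_Suc_imp_elem numeral_2_eq_2)
    then show ?thesis
      using same_margins_pair_clique[OF T(2)[unfolded X cd] single[OF rV]] add_mset_commute by fastforce
  qed
  \<comment> \<open>The ends of an edge in \<open>S\<close> form a clique on which \<open>a\<close>
    and \<open>b\<close> differ at both places, so a record follows \<open>a\<close> at both ends or
    at neither.\<close>
  have inv: "(c u = a u) = (c w = a w)"
    if "same_margins E V X {#c, d#}" "(u, w) \<in> R" for c d u w
  proof -
    have "clique (V, E) {u, w}" "a u \<noteq> b u" "a w \<noteq> b w"
      using that(2) assms(2,4) by (auto simp: R_def S_def clique_def dest: symD)
    with same_margins_pair_clique[OF that(1)[unfolded X]] show ?thesis by fastforce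
  qed
  have other: "\<exists>v\<in>S. c v \<noteq> a v" if "same_margins E V X {#c, d#}" "X \<noteq> {#c, d#}"
      "set_mset {#c, d#} \<subseteq> extensional V" for c d
  proof -
    have "a \<notin># {#c, d#}"
      using same_margins_pair_disjoint[OF that(1) size ext(1) that(3,2), of a] by (simp add: X)
    then have "c \<noteq> a" by auto
    then obtain v where v: "c v \<noteq> a v" by (auto simp: fun_eq_iff)
    have "c \<in> extensional V" using that(3) by simp
    then have "v \<in> V" using v ab(1) by (metis extensional_arb)
    then have "v \<in> S"
      using v same_margins_pair_clique[OF that(1)[unfolded X] single[OF \<open>v \<in> V\<close>]] by (auto simp: S_def)
    then show ?thesis using v by blast
  qed
  have S: "S \<subseteq> V" "finite S" using assms(1) by (auto simp: S_def)
  obtain c d where c: "Y = {#c, d#}" "c r = a r" using orient[OF sizes(1) Y] by blast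
  obtain c' d' where c': "Z = {#c', d'#}" "c' r = a r" using orient[OF sizes(2) Z] by blast
  note m = Y[unfolded c(1)] and m' = Z[unfolded c'(1)]
  have "same_margins E V Y Z" using Y Z same_margins_sym same_margins_trans by metis
  then have "c \<notin># Z"
    using same_margins_pair_disjoint[of E V Y Z c] sizes(1) ext(2,3) neq(3) c(1) by simp
  then have "c \<noteq> c'" using c'(1) by auto
  then obtain p where p: "c p \<noteq> c' p" by (auto simp: fun_eq_iff)
  have cc: "c \<in> extensional V" "c' \<in> extensional V" using ext c(1) c'(1) by auto
  then have pV: "p \<in> V" using p by (metis extensional_arb)
  have two: "c p = a p \<or> c p = b p" "c' p = a p \<or> c' p = b p"
    using same_margins_pair_clique[OF m[unfolded X] single[OF pV]]
      same_margins_pair_clique[OF m'[unfolded X] single[OF pV]] by auto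
  then have pS: "p \<in> S" using p pV by (auto simp: S_def)
  obtain q where q: "q \<in> S" "c q \<noteq> a q" using other[OF m] neq ext c by blast
  obtain q' where q': "q' \<in> S" "c' q' \<noteq> a q'" using other[OF m'] neq ext c' by blast
  \<comment> \<open>At \<open>p\<close> exactly one of \<open>c\<close> and \<open>c'\<close>
    follows \<open>a\<close>. That record must leave \<open>a\<close> elsewhere in \<open>S\<close>,
    at \<open>q\<close> or \<open>q'\<close>; this vertex, \<open>p\<close> and \<open>r\<close> lie
    in three classes.\<close>
  have "3 \<le> card (S // R\<^sup>*)"
  proof (cases "c' p = a p")
    case True
    then show ?thesis
      using three_le_card_classes[OF S(2) r pS q'(1), of R "\<lambda>v. c v = a v" "\<lambda>v. c' v = a v"]
        inv[OF m] inv[OF m'] c(2) c'(2) p q' by auto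
  next
    case False
    then have "c p = a p" using two p by auto
    then show ?thesis
      using three_le_card_classes[OF S(2) r pS q(1), of R "\<lambda>v. c' v = a v" "\<lambda>v. c v = a v"]
        inv[OF m] inv[OF m'] c(2) c'(2) p q by auto
  qed
  then show ?thesis
    using S(1) by (auto simp: connected_components_def induced_subgraph_def R_def)
qed

text \<open>Take records that differ exactly on \<open>S\<close>, with values 0 and 1, and swap one
  component or another. The third component ensures that these two swaps are not complementary,
  since those would give the same table.\<close>

lemma three_components_imp_three_tables:
  assumes "E \<subseteq> V \<times> V" "sym E" and levels: "\<And>\<delta>. \<delta> \<in> V \<Longrightarrow> 2 \<le> I \<delta>"
    and S: "S \<subseteq> V" and card: "3 \<le> card (connected_components (induced_subgraph (V, E) S))"
  shows "\<exists>X Y Z. size X = 2 \<and> set_mset X \<subseteq> cells I V \<and> set_mset Y \<subseteq> cells I V \<and>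
    set_mset Z \<subseteq> cells I V \<and> same_margins E V X Y \<and> same_margins E V X Z \<and>
    X \<noteq> Y \<and> X \<noteq> Z \<and> Y \<noteq> Z"
proof -
  define R where "R = E \<inter> S \<times> S"
  have "3 \<le> card (S // R\<^sup>*)"
    using card by (simp add: connected_components_def induced_subgraph_def R_def)
  then obtain C1 C2 C3 where C: "C1 \<in> S // R\<^sup>*" "C2 \<in> S // R\<^sup>*" "C3 \<in> S // R\<^sup>*"
    "C1 \<noteq> C2" "C1 \<noteq> C3" "C2 \<noteq> C3"
    by (smt (verit) card_3_iff insert_subset obtain_subset_with_card_n)
  obtain p1 p2 p3 where p: "C1 = R\<^sup>* `` {p1}" "C2 = R\<^sup>* `` {p2}" "C3 = R\<^sup>* `` {p3}"
    "p1 \<in> S" "p2 \<in> S" "p3 \<in> S"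
    using C(1-3) by (auto elim!: quotientE)
  have "sym R" using assms(2) by (auto simp: R_def sym_def)
  then have eq: "equiv UNIV (R\<^sup>*)"
    by (auto intro!: equivI sym_rtrancl simp: refl_rtrancl trans_rtrancl)
  have notin: "x \<notin> R\<^sup>* `` {y}" if "R\<^sup>* `` {x} \<noteq> R\<^sup>* `` {y}" for x y
    using equiv_class_eq[OF eq, of y x] that by blast
  have pin: "p1 \<in> C1" "p2 \<in> C2" "p3 \<in> C3" using p by auto
  have pout: "p1 \<notin> C2" "p2 \<notin> C1" "p3 \<notin> C1" "p3 \<notin> C2"
    unfolding p(1-3) using C(4-6) p(1-3) by (metis notin)+
  define a where "a = (\<lambda>v\<in>V. 0 :: nat)"
  define b where "b = (\<lambda>v\<in>V. if v \<in> S then 1 else 0 :: nat)"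
  have abc: "a \<in> cells I V" "b \<in> cells I V"
    using levels by (fastforce simp: a_def b_def cells_def)+
  have sw: "swappable E V a b (R\<^sup>* `` {x})" if "x \<in> S" for x
    unfolding swappable_def
  proof (intro conjI ballI impI)
    have sub: "R\<^sup>* `` {x} \<subseteq> S"
    proof
      fix y assume "y \<in> R\<^sup>* `` {x}"
      then have "(x, y) \<in> R\<^sup>*" by simp
      then show "y \<in> S" using that by (induction rule: rtrancl_induct) (auto simp: R_def)
    qed
    then show "R\<^sup>* `` {x} \<subseteq> V" using S by blast
    fix u w assume u: "u \<in> R\<^sup>* `` {x}" and w: "w \<in> V - R\<^sup>* `` {x}" and "(u, w) \<in> E"
    have "w \<notin> S"
    proof
      assume "w \<in> S"
      then have "(u, w) \<in> R" using u sub \<open>(u, w) \<in> E\<close> by (auto simp: R_def)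
      then show False using u w by (auto intro: rtrancl_into_rtrancl)
    qed
    then show "a u = b u \<or> a w = b w" by (auto simp: a_def b_def)
  qed
  define Y where "Y = {#override_on a b C1, override_on b a C1#}"
  define Z where "Z = {#override_on a b C2, override_on b a C2#}"
  have val: "a x = 0" "b x = 1" if "x \<in> S" for x using that S by (auto simp: a_def b_def)
  note vals = val[OF p(4)] val[OF p(5)] val[OF p(6)]
  have mY: "same_margins E V {#a, b#} Y" and mZ: "same_margins E V {#a, b#} Z"
    unfolding Y_def Z_def p(1,2) by (intro swappable_same_margins sw p)+
  have override: "override_on x y T \<in> cells I V" if "x \<in> cells I V" "y \<in> cells I V" for x y T
    using that by (auto simp: cells_def override_on_def PiE_def extensional_def Pi_def)
  have o: "override_on x y T p = (if p \<in> T then y p else x p)" for x y :: cell and T p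
    by (simp add: override_on_def)
  \<comment> \<open>The last inequality is witnessed by \<open>p3\<close>, which lies in neither
    swapped component.\<close>
  have "a \<noteq> override_on a b C1" "a \<noteq> override_on b a C1"
    "a \<noteq> override_on a b C2" "a \<noteq> override_on b a C2"
    "override_on a b C1 \<noteq> override_on a b C2" "override_on a b C1 \<noteq> override_on b a C2"
    using vals pin pout by (metis o zero_neq_one)+
  then have "a \<notin># Y" "a \<notin># Z" "override_on a b C1 \<notin># Z"
    by (auto simp: Y_def Z_def)
  moreover have "a \<in># {#a, b#}" "override_on a b C1 \<in># Y" by (auto simp: Y_def)
  ultimately have "{#a, b#} \<noteq> Y" "{#a, b#} \<noteq> Z" "Y \<noteq> Z" by metis+
  moreover have "set_mset Y \<subseteq> cells I V" "set_mset Z \<subseteq> cells I V"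
    using override abc by (auto simp: Y_def Z_def)
  ultimately show ?thesis
    using mY mZ abc by (intro exI[of _ "{#a, b#}"] exI[of _ Y] exI[of _ Z]) auto
qed

section \<open>The quadratic moves of a chordal model\<close>

lemma finite_cells: "finite V \<Longrightarrow> finite (cells I V)"
  by (auto simp: cells_def intro: finite_PiE)

lemma cells_extensional: "set_mset X \<subseteq> cells I V \<Longrightarrow> set_mset X \<subseteq> extensional V"
  by (auto simp: cells_def PiE_def)

lemma tab_in_tables: "set_mset X \<subseteq> cells I V \<Longrightarrow> tab X \<in> tables V I"
  by (auto simp: tables_def int_arrays_def tab_def count_eq_zero_iff)

lemma ex_tab:
  assumes "finite V" "n \<in> tables V I"
  shows "\<exists>X. set_mset X \<subseteq> cells I V \<and> n = tab X"
proof -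
  have n: "i \<notin> cells I V \<Longrightarrow> n i = 0" "0 \<le> n i" for i
    using assms(2) by (auto simp: tables_def int_arrays_def)
  have "{i. 0 < nat (n i)} \<subseteq> cells I V" using n by (auto intro: ccontr)
  then have "finite {i. 0 < nat (n i)}" using finite_cells[OF assms(1)] finite_subset by blast
  then have count: "count (Abs_multiset (\<lambda>i. nat (n i))) = (\<lambda>i. nat (n i))" by simp
  show ?thesis
  proof (intro exI conjI)
    show "n = tab (Abs_multiset (\<lambda>i. nat (n i)))" using n by (simp add: tab_def count)
    show "set_mset (Abs_multiset (\<lambda>i. nat (n i))) \<subseteq> cells I V"
      using n by (auto simp: set_mset_def count intro: ccontr)
  qed
qed

text \<open>The model records only maximal cliques, but every clique lies in one, and its margin is
  a further restriction of that one.\<close>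

lemma marginal_frequencies_tab_eq_iff:
  assumes V: "finite V" and \<D>: "\<D> = maximal_cliques (V, E)"
    and X: "set_mset X \<subseteq> cells I V" and Y: "set_mset Y \<subseteq> cells I V"
  shows "marginal_frequencies V I \<D> (tab X) = marginal_frequencies V I \<D> (tab Y) \<longleftrightarrow>
    same_margins E V X Y" (is "?f X = ?f Y \<longleftrightarrow> _")
proof
  assume eq: "?f X = ?f Y"
  show "same_margins E V X Y" unfolding same_margins_def
  proof (intro allI impI)
    fix C assume "clique (V, E) C"
    then obtain D where D: "D \<in> maximal_cliques (V, E)" "C \<subseteq> D"
      using ex_maximal_clique[OF V] by blast
    then have DV: "D \<subseteq> V" by (auto simp: maximal_cliques_def clique_def)
    have "count (image_mset (\<lambda>i. restrict i D) X) k = count (image_mset (\<lambda>i. restrict i D) Y) k" for k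
    proof (cases "k \<in> cells I D")
      case True
      have "?f X (D, k) = ?f Y (D, k)" using eq by simp
      then show ?thesis
        using True D(1) marginal_tab[OF V DV X True] marginal_tab[OF V DV Y True] \<D>
        by (simp add: marginal_frequencies_def)
    next
      case False
      have "restrict i D \<in> cells I D" if "i \<in> cells I V" for i
        using that DV by (auto simp: cells_def)
      then have "k \<notin># image_mset (\<lambda>i. restrict i D) Z" if "set_mset Z \<subseteq> cells I V" for Z
        using False that by auto
      then show ?thesis using X Y by (metis not_in_iff)
    qed
    then have "image_mset (\<lambda>i. restrict i D) X = image_mset (\<lambda>i. restrict i D) Y"
      by (rule multiset_eqI)
    then have "image_mset (\<lambda>i. restrict i C) (image_mset (\<lambda>i. restrict i D) X) =
      image_mset (\<lambda>i. restrict i C) (image_mset (\<lambda>i. restrict i D) Y)" by (rule arg_cong)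
    moreover have "D \<inter> C = C" using D(2) by blast
    ultimately show "image_mset (\<lambda>i. restrict i C) X = image_mset (\<lambda>i. restrict i C) Y"
      by (simp add: multiset.map_comp comp_def)
  qed
next
  assume sm: "same_margins E V X Y"
  show "?f X = ?f Y"
  proof (intro ext, clarify)
    fix D k
    show "?f X (D, k) = ?f Y (D, k)"
    proof (cases "D \<in> \<D> \<and> k \<in> cells I D")
      case True
      then have D: "clique (V, E) D" "D \<subseteq> V" using \<D> by (auto simp: maximal_cliques_def clique_def)
      then have "image_mset (\<lambda>i. restrict i D) X = image_mset (\<lambda>i. restrict i D) Y"
        using sm by (simp add: same_margins_def)
      then show ?thesis
        using True marginal_tab[OF V D(2) X] marginal_tab[OF V D(2) Y]
        by (simp add: marginal_frequencies_def)
    next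
      case False
      then show ?thesis by (auto simp: marginal_frequencies_def)
    qed
  qed
qed

text \<open>The independence graph is represented by its adjacency \<open>E\<close>; decomposability
  enters as chordality together with the description of \<open>\<D>\<close> by maximal
  cliques.\<close>

locale chordal_model =
  fixes V :: "nat set" and I :: "nat \<Rightarrow> nat" and \<D> :: "nat set set" and E :: "(nat \<times> nat) set"
  assumes finite_V: "finite V" and levels: "\<And>\<delta>. \<delta> \<in> V \<Longrightarrow> 2 \<le> I \<delta>"
    and E: "E \<subseteq> V \<times> V" "sym E" "irrefl E" "chordal (V, E)"
    and \<D>: "\<D> = maximal_cliques (V, E)"
begin

abbreviation A :: "(cell \<Rightarrow> int) \<Rightarrow> nat set \<times> cell \<Rightarrow> int" where
  "A \<equiv> marginal_frequencies V I \<D>"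

abbreviation fib :: "(nat set \<times> cell \<Rightarrow> int) \<Rightarrow> (cell \<Rightarrow> int) set" where
  "fib \<equiv> fiber V I \<D>"

lemmas A_tab_eq_iff = marginal_frequencies_tab_eq_iff[OF finite_V \<D>]

lemma tab_in_fiber: "set_mset X \<subseteq> cells I V \<Longrightarrow> tab X \<in> fib b \<longleftrightarrow> A (tab X) = b"
  by (auto simp: fiber_def tab_in_tables)

lemma fiberE:
  assumes "z \<in> fib b"
  obtains Z where "set_mset Z \<subseteq> cells I V" "z = tab Z" "A (tab Z) = b"
proof -
  have "z \<in> tables V I" "A z = b" using assms by (simp_all add: fiber_def)
  then show ?thesis using ex_tab[OF finite_V] that by metis
qed

lemma override_on_cells: "a \<in> cells I V \<Longrightarrow> b \<in> cells I V \<Longrightarrow> override_on a b T \<in> cells I V"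
  by (auto simp: cells_def override_on_def PiE_def extensional_def Pi_def)

text \<open>All nonzero moves between two-record tables of a common fiber; with every move its
  negative occurs too.\<close>

definition quadratic_moves :: "(cell \<Rightarrow> int) set" where
  "quadratic_moves = {tab {#c, d#} - tab {#a, b#} | a b c d.
     {a, b, c, d} \<subseteq> cells I V \<and> same_margins E V {#a, b#} {#c, d#} \<and> {#a, b#} \<noteq> {#c, d#}}"

lemma quadratic_movesI:
  assumes "{a, b, c, d} \<subseteq> cells I V" "same_margins E V {#a, b#} {#c, d#}" "{#a, b#} \<noteq> {#c, d#}"
  shows "tab {#c, d#} - tab {#a, b#} \<in> quadratic_moves"
  using assms unfolding quadratic_moves_def by blast

lemma finite_quadratic_moves: "finite quadratic_moves"
proof (rule finite_subset)
  let ?C = "cells I V"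
  show "quadratic_moves \<subseteq>
      (\<lambda>(a, b, c, d). tab {#c, d#} - tab {#a, b#}) ` (?C \<times> ?C \<times> ?C \<times> ?C)"
    unfolding quadratic_moves_def by (force simp: image_iff)
  show "finite \<dots>" using finite_cells[OF finite_V] by simp
qed

lemma quadratic_moves_subset: "quadratic_moves \<subseteq> moves V I \<D>"
proof
  fix z assume "z \<in> quadratic_moves"
  then obtain a b c d where z: "z = tab {#c, d#} - tab {#a, b#}" "{a, b, c, d} \<subseteq> cells I V"
    "same_margins E V {#a, b#} {#c, d#}" by (auto simp: quadratic_moves_def)
  then have "A (tab {#c, d#}) = A (tab {#a, b#})"
    using A_tab_eq_iff[of "{#a, b#}" I "{#c, d#}"] by simp
  then show "z \<in> moves V I \<D>"
    unfolding z(1) using z(2) tab_in_fiber by (intro fiber_diff_in_moves) auto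
qed

text \<open>The untouched records cancel in the difference of the tables, leaving a quadratic move.
  A swap without effect is covered by the empty path.\<close>

lemma swap_step:
  assumes "(X, Y) \<in> swaps E V" "set_mset X \<subseteq> cells I V" "tab X \<in> fib b"
    and M: "\<And>z. z \<in> quadratic_moves \<Longrightarrow> z \<in> M \<or> - z \<in> M"
  shows "(tab X, tab Y) \<in> (steps (fib b) M)\<^sup>*"
proof (cases "X = Y")
  case False
  obtain a c T R where *: "X = add_mset a (add_mset c R)"
    "Y = add_mset (override_on a c T) (add_mset (override_on c a T) R)" "swappable E V a c T"
    using assms(1) by (auto simp: swaps_def)
  let ?a = "override_on a c T" and ?c = "override_on c a T"
  have "{a, c, ?a, ?c} \<subseteq> cells I V" using assms(2) override_on_cells by (simp add: *)
  then have "tab {#?a, ?c#} - tab {#a, c#} \<in> quadratic_moves"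
  proof (rule quadratic_movesI[OF _ swappable_same_margins[OF *(3)]])
    show "{#a, c#} \<noteq> {#?a, ?c#}"
    proof
      assume "{#a, c#} = {#?a, ?c#}"
      then have "{#a, c#} + R = {#?a, ?c#} + R" by (rule arg_cong)
      then show False using False by (simp add: *(1,2))
    qed
  qed
  moreover have "tab Y - tab X = tab {#?a, ?c#} - tab {#a, c#}"
    using tab_union[of "{#?a, ?c#}" R] tab_union[of "{#a, c#}" R] by (simp add: *)
  ultimately have "tab Y - tab X \<in> M \<or> - (tab Y - tab X) \<in> M" using M by metis
  moreover have "tab Y = tab X + (tab Y - tab X)" "tab Y = tab X - - (tab Y - tab X)" by simp_all
  moreover have "tab Y \<in> fib b"
  proof -
    have Y: "set_mset Y \<subseteq> cells I V"
      using swaps_invariant[OF assms(1,2)] override_on_cells by blast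
    then show ?thesis
      using A_tab_eq_iff[OF assms(2) Y] swaps_same_margins[OF assms(1)] assms(2,3) tab_in_fiber by metis
  qed
  ultimately have "(tab X, tab Y) \<in> steps (fib b) M"
    using assms(3) unfolding steps_def by blast
  then show ?thesis by blast
qed simp

text \<open>Steps may use either sign, so one representative of each quadratic move realizes all
  swaps, and swaps connect every fiber.\<close>

lemma markov_basis_if_quadratic:
  assumes "finite M" "M \<subseteq> moves V I \<D>" and M: "\<And>z. z \<in> quadratic_moves \<Longrightarrow> z \<in> M \<or> - z \<in> M"
  shows "markov_basis V I \<D> M"
  unfolding markov_basis_def
proof (intro conjI allI ballI assms)
  fix b x y assume "x \<in> fib b" "y \<in> fib b"
  then obtain X Y where X: "set_mset X \<subseteq> cells I V" "x = tab X" "A (tab X) = b"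
    and Y: "set_mset Y \<subseteq> cells I V" "y = tab Y" "A (tab Y) = b" by (metis fiberE)
  then have "same_margins E V X Y" using A_tab_eq_iff by metis
  then have "(X, Y) \<in> (swaps E V)\<^sup>*"
    using chordal_swaps_connected[OF E(4,2,3) finite_V] X(1) Y(1) cells_extensional by blast
  then have "(tab X, tab Y) \<in> (steps (fib b) M)\<^sup>*"
  proof (induction rule: rtrancl_induct)
    case (step Z Z')
    have Z: "set_mset Z \<subseteq> cells I V"
      using swaps_rtrancl_invariant[OF step.hyps(1) X(1)] override_on_cells by blast
    have "same_margins E V X Z" using step.hyps(1) by (rule swaps_rtrancl_same_margins)
    then have "tab Z \<in> fib b" using A_tab_eq_iff[OF X(1) Z] X(3) tab_in_fiber[OF Z] by simp
    then show ?case using swap_step[OF step.hyps(2) Z _ M] step.IH by (meson rtrancl_trans)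
  qed simp
  then show "(x, y) \<in> (steps (fib b) M)\<^sup>*" by (simp add: X Y)
qed

section \<open>Uniqueness and its failure\<close>

lemma unique_if_few_components:
  assumes few: "\<And>S. S \<subseteq> V \<Longrightarrow> card (connected_components (induced_subgraph (V, E) S)) < 3"
  shows "\<exists>!B. B \<in> up_to_sign ` {M. minimal_markov_basis V I \<D> M}"
proof -
  \<comment> \<open>The fiber of the two-record table consists of just two tables, so any nontrivial
    step inside it is the given move up to sign.\<close>
  have forced: "z \<in> M \<or> - z \<in> M" if M: "markov_basis V I \<D> M" and z: "z \<in> quadratic_moves" for M z
  proof -
    obtain a b c d where *: "z = tab {#c, d#} - tab {#a, b#}" "{a, b, c, d} \<subseteq> cells I V"
      "same_margins E V {#a, b#} {#c, d#}" "{#a, b#} \<noteq> {#c, d#}"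
      using z unfolding quadratic_moves_def by blast
    define X Y where "X = {#a, b#}" and "Y = {#c, d#}"
    have X: "set_mset X \<subseteq> cells I V" "size X = 2" and Y: "set_mset Y \<subseteq> cells I V"
      using *(2) by (auto simp: X_def Y_def)
    have XY: "X \<noteq> Y" "same_margins E V X Y" using * by (auto simp: X_def Y_def)
    let ?F = "fib (A (tab X))"
    have F: "tab X \<in> ?F" "tab Y \<in> ?F" "tab X \<noteq> tab Y"
      using X Y XY A_tab_eq_iff[OF X(1) Y] tab_in_fiber tab_inject by auto
    have two: "p = tab X \<or> p = tab Y" if p: "p \<in> ?F" for p
    proof (rule ccontr)
      obtain P where P: "set_mset P \<subseteq> cells I V" "p = tab P" "A (tab P) = A (tab X)"
        using p by (rule fiberE)
      assume "\<not> (p = tab X \<or> p = tab Y)"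
      then have "X \<noteq> P" "Y \<noteq> P" using P by auto
      moreover have "same_margins E V X P" using P A_tab_eq_iff[OF X(1) P(1)] by simp
      ultimately have "\<exists>S\<subseteq>V. 3 \<le> card (connected_components (induced_subgraph (V, E) S))"
        using three_tables_imp_three_components[OF finite_V E(1,3,2) X(2)] X Y P XY cells_extensional
        by metis
      then show False using few by (metis not_le)
    qed
    obtain p q where pq: "p \<in> ?F" "q \<in> ?F" "p \<noteq> q" "q - p \<in> M \<or> p - q \<in> M"
      using markov_basis_step[OF M F] by blast
    have "z = tab Y - tab X" "- z = tab X - tab Y" using *(1) by (simp_all add: X_def Y_def)
    then show ?thesis using two[OF pq(1)] two[OF pq(2)] pq(3,4) by metis
  qed
  have eq: "up_to_sign M = up_to_sign quadratic_moves" if M: "minimal_markov_basis V I \<D> M" for M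
  proof -
    have Mb: "markov_basis V I \<D> M" using M by (simp add: minimal_markov_basis_def)
    \<comment> \<open>The quadratic part of \<open>M\<close>, up to sign, is already a Markov basis
      because all quadratic moves are forced; minimality makes it all of \<open>M\<close>.\<close>
    define M' where "M' = {z \<in> M. z \<in> quadratic_moves \<or> - z \<in> quadratic_moves}"
    have "markov_basis V I \<D> M'"
    proof (rule markov_basis_if_quadratic)
      show "finite M'" "M' \<subseteq> moves V I \<D>"
        using Mb by (auto simp: M'_def markov_basis_def)
      show "z \<in> M' \<or> - z \<in> M'" if "z \<in> quadratic_moves" for z
        using forced[OF Mb that] that by (auto simp: M'_def)
    qed
    moreover have "M' \<subseteq> M" by (auto simp: M'_def)
    ultimately have MM: "M' = M" using M unfolding minimal_markov_basis_def by blast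
    have sym: "{- z, - (- z)} = {z, - z}" for z :: "cell \<Rightarrow> int" by auto
    have mem: "{z, - z} \<in> up_to_sign N" if "z \<in> N \<or> - z \<in> N" for z N
      using that
    proof
      assume "- z \<in> N"
      then have "{- z, - (- z)} \<in> up_to_sign N" unfolding up_to_sign_def by (rule imageI)
      then show ?thesis by (simp only: sym)
    qed (simp add: up_to_sign_def)
    show ?thesis
    proof
      show "up_to_sign M \<subseteq> up_to_sign quadratic_moves"
      proof
        fix s assume "s \<in> up_to_sign M"
        then obtain z where "z \<in> M'" "s = {z, - z}" using MM by (auto simp: up_to_sign_def)
        then show "s \<in> up_to_sign quadratic_moves" using mem by (simp add: M'_def)
      qed
      show "up_to_sign quadratic_moves \<subseteq> up_to_sign M"
      proof
        fix s assume "s \<in> up_to_sign quadratic_moves"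
        then obtain z where "z \<in> quadratic_moves" "s = {z, - z}" by (auto simp: up_to_sign_def)
        then show "s \<in> up_to_sign M" using mem forced[OF Mb] by simp
      qed
    qed
  qed
  have "markov_basis V I \<D> quadratic_moves"
    using finite_quadratic_moves quadratic_moves_subset by (intro markov_basis_if_quadratic) auto
  then obtain M where "minimal_markov_basis V I \<D> M" using ex_minimal_markov_basis by metis
  then show ?thesis using eq by blast
qed

lemma not_unique_if_three_components:
  assumes "S \<subseteq> V" "3 \<le> card (connected_components (induced_subgraph (V, E) S))"
  shows "\<not> (\<exists>!B. B \<in> up_to_sign ` {M. minimal_markov_basis V I \<D> M})"
proof -
  obtain X Y Z where size: "size X = 2" and sub: "set_mset X \<subseteq> cells I V"
    "set_mset Y \<subseteq> cells I V" "set_mset Z \<subseteq> cells I V"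
    and sm: "same_margins E V X Y" "same_margins E V X Z" and neq: "X \<noteq> Y" "X \<noteq> Z" "Y \<noteq> Z"
    using three_components_imp_three_tables[of E V I S] E(1,2) levels assms by blast
  let ?b = "A (tab X)"
  \<comment> \<open>Every table of this fiber has the same margins as \<open>X\<close>, hence two
    records, so distinct ones share no record.\<close>
  have disj: "p i = 0 \<or> q i = 0" if p: "p \<in> fib ?b" and q: "q \<in> fib ?b" and "p \<noteq> q" for p q i
  proof -
    obtain P where P: "set_mset P \<subseteq> cells I V" "p = tab P" "A (tab P) = ?b" using p by (rule fiberE)
    obtain Q where Q: "set_mset Q \<subseteq> cells I V" "q = tab Q" "A (tab Q) = ?b" using q by (rule fiberE)
    have "same_margins E V P Q" "same_margins E V X P"
      using P Q sub(1) A_tab_eq_iff by metis+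
    then have "i \<notin># P \<or> i \<notin># Q"
      using same_margins_pair_disjoint[of E V P Q i] same_margins_size[of E V X P] size P Q
        cells_extensional that(3) by metis
    then show ?thesis by (auto simp: P(2) Q(2) tab_def count_eq_zero_iff)
  qed
  have mb: "markov_basis V I \<D> quadratic_moves"
    using finite_quadratic_moves quadratic_moves_subset by (intro markov_basis_if_quadratic) auto
  have F: "tab X \<in> fib ?b" "tab Y \<in> fib ?b" "tab Z \<in> fib ?b"
    using sub sm tab_in_fiber A_tab_eq_iff[OF sub(1,2)] A_tab_eq_iff[OF sub(1,3)] by auto
  show ?thesis
  proof (rule not_unique_minimal_markov_basis[OF mb F])
    show "tab X \<noteq> tab Y" "tab X \<noteq> tab Z" "tab Y \<noteq> tab Z" using neq by (simp_all add: tab_inject)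
  qed (rule disj)
qed

end

theorem corollary1:
  fixes m :: nat and I :: "nat \<Rightarrow> nat" and \<D> :: "nat set set"
  assumes "1 \<le> m"
    and "\<And>\<delta>. \<delta> \<in> {1..m} \<Longrightarrow> 2 \<le> I \<delta>"
    and "generating_class {1..m} \<D>"
    and "decomposable {1..m} \<D>"
  shows "(\<exists>!B. B \<in> up_to_sign ` {M. minimal_markov_basis {1..m} I \<D> M}) \<longleftrightarrow>
    (\<forall>S\<subseteq>{1..m}.
       card (connected_components (induced_subgraph (independence_graph {1..m} \<D>) S)) < 3)"
proof -
  define E where "E = snd (independence_graph {1..m} \<D>)"
  have G: "independence_graph {1..m} \<D> = ({1..m}, E)"
    by (simp add: E_def independence_graph_def)
  interpret chordal_model "{1..m}" I \<D> E
  proof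
    show "E \<subseteq> {1..m} \<times> {1..m}" "sym E" "irrefl E"
      by (auto simp: E_def independence_graph_def sym_def irrefl_def)
    show "chordal ({1..m}, E)" "\<D> = maximal_cliques ({1..m}, E)"
      using assms(4) G unfolding decomposable_def by auto
  qed (use assms(2) in auto)
  show ?thesis
    unfolding G using unique_if_few_components not_unique_if_three_components by (metis not_le)
qed

end
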